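(* Let $H\in\mathbb{C}^{N\times N}$ be Hermitian negative definite with eigenvalues $\lambda_1\le\dots\le\lambda_N<0$ and suppose $\lambda_m<\lambda_{m+1}$. Let $\alpha\in(0,1)$. Then there exists $\mu_0(\alpha)>0$ such that for all $0<\mu<\mu_0(\alpha)$ and all $X_\mu\in S_\mu$, $$\|\widetilde P_{X_\mu}-P_0\|_F\le\frac{2\mu m\sqrt{N}}{\alpha^2(\lambda_{m+1}-\lambda_m)},\qquad \|P_{X_\mu}-P_0\|_F\le\frac{4\mu m\sqrt{N}}{\alpha^2(\lambda_{m+1}-\lambda_m)}.$$
   Context: $N,m$ are positive integers with $m<N$ (so that $\lambda_{m+1}$ makes sense), and eigenvalues are listed with multiplicity. For $X\in\mathbb{C}^{N\times m}$, $E_0(X)=\operatorname{tr}\bigl[(2I-X^*X)X^*HX\bigr]$, where $X^*$ is the conjugate transpose, and for $\mu\ge0$, $E_\mu(X)=E_0(X)+\mu\sum_{i,j}|X_{ij}|$. The set $S_\mu$ is the set of all global minimizers of $E_\mu$ over $\mathbb{C}^{N\times m}$ (with $S_0$ the set of global minimizers of $E_0$). $\|\cdot\|_F$ is the Frobenius norm. The density matrix is $P_0=X_0X_0^*$ for any $X_0\in S_0$; it is the orthogonal projection onto the span of the eigenvectors of $H$ for $\lambda_1,\dots,\lambda_m$. For $X_\mu\in S_\mu$, $\widetilde P_{X_\mu}=X_\mu X_\mu^*$ and $P_{X_\mu}=X_\mu(X_\mu^*X_\mu)^{-1}X_\mu^*$ (the latter for $X_\mu$ of full column rank). The threshold $\mu_0(\alpha)$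 may depend on $H$, $N$, $m$ and $\alpha$. *)

theory Defs
  imports "HOL-Analysis.Analysis" "HOL-Computational_Algebra.Polynomial"
begin

text \<open>
  An \<open>N \<times> m\<close> complex matrix has type \<open>complex^'m^'n\<close> with \<open>N = CARD('n)\<close> and \<open>m = CARD('m)\<close>;
  its entry in row \<open>i\<close> and column \<open>j\<close> is \<open>X $ i $ j\<close>.  The library norm of this type is the
  \<open>L2\<close> norm of the \<open>L2\<close> norms of the rows, that is, the Frobenius norm.
\<close>

definition conj_transpose :: "complex^'m^'n \<Rightarrow> complex^'n^'m" where
  "conj_transpose X = (\<chi> i j. cnj (X $ j $ i))"

definition hermitian :: "complex^'n^'n \<Rightarrow> bool" where
  "hermitian H \<longleftrightarrow> conj_transpose H = H"

text \<open>
  The sum is \<open>v\<^sup>* H v\<close>, which is real for Hermitian \<open>H\<close>.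
\<close>

definition negative_definite :: "complex^'n^'n \<Rightarrow> bool" where
  "negative_definite H \<longleftrightarrow> (\<forall>v. v \<noteq> 0 \<longrightarrow> Re (\<Sum>i\<in>UNIV. cnj (v $ i) * (H *v v) $ i) < 0)"

definition charpoly :: "'a::comm_ring_1^'n^'n \<Rightarrow> 'a poly" where
  "charpoly A = det (mat [:0, 1:] - (\<chi> i j. [:A $ i $ j:]))"

text \<open>
  \<open>lam 1 \<le> \<dots> \<le> lam N\<close> are the eigenvalues of \<open>A\<close>, repeated according to their algebraic
  multiplicity; the values of \<open>lam\<close> outside \<open>{1..N}\<close> are irrelevant.
\<close>

definition ordered_eigenvalues :: "complex^'n^'n \<Rightarrow> (nat \<Rightarrow> real) \<Rightarrow> bool" where
  "ordered_eigenvalues A lam \<longleftrightarrow>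
     mono_on {1..CARD('n)} lam \<and>
     charpoly A = (\<Prod>i = 1..CARD('n). [:- complex_of_real (lam i), 1:])"

text \<open>
  For Hermitian \<open>H\<close> the trace below is real, so taking the real part loses nothing.
\<close>

definition energy0 :: "complex^'n^'n \<Rightarrow> complex^'m^'n \<Rightarrow> real" where
  "energy0 H X =
     Re (trace ((mat 2 - conj_transpose X ** X) ** (conj_transpose X ** H ** X)))"

definition energy :: "complex^'n^'n \<Rightarrow> real \<Rightarrow> complex^'m^'n \<Rightarrow> real" where
  "energy H \<mu> X = energy0 H X + \<mu> * (\<Sum>i\<in>UNIV. \<Sum>j\<in>UNIV. cmod (X $ i $ j))"

definition minimizers :: "complex^'n^'n \<Rightarrow> real \<Rightarrow> (complex^'m^'n) set" where
  "minimizers H \<mu> = {X. \<forall>Y :: complex^'m^'n. energy H \<mu> X \<le> energy H \<mu> Y}"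

definition density_matrix :: "complex^'m^'n \<Rightarrow> complex^'n^'n" where
  "density_matrix X = X ** conj_transpose X"

text \<open>
  Meaningful only for \<open>X\<close> of full column rank: otherwise \<open>X\<^sup>* X\<close> is singular and \<open>matrix_inv\<close>
  returns an arbitrary matrix.
\<close>

definition range_projector :: "complex^'m^'n \<Rightarrow> complex^'n^'n" where
  "range_projector X = X ** matrix_inv (conj_transpose X ** X) ** conj_transpose X"

end

theory Submission
  imports Defs
begin

text \<open>
  Let \<open>Q = X X\<^sup>*\<close> and let \<open>P\<close> be the orthogonal projector onto the column space of \<open>X\<close>.  As \<open>P Q = Q = Q P\<close>,
  the energy \<open>E\<^sub>0(X) = tr H (2 Q - Q\<^sup>2)\<close> equals \<open>tr H P + tr (-H) (P - Q)\<^sup>2\<close>, and \<open>tr H P - tr H P\<^sub>0\<close> is at least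
  half the spectral gap times \<open>\<parallel>P - P\<^sub>0\<parallel>\<^sup>2\<close>.  So the excess energy controls \<open>P - P\<^sub>0\<close> and \<open>P - Q\<close>; near \<open>P\<^sub>0\<close>,
  where \<open>P - P\<^sub>0\<close> and \<open>P - Q\<close> are almost orthogonal, it exceeds \<open>5/12\<close> of the gap times \<open>\<parallel>Q - P\<^sub>0\<parallel>\<^sup>2\<close>.
  For a minimizer \<open>X\<close> of \<open>E\<^sub>\<mu>\<close>, comparison with a minimizer \<open>X\<^sub>0\<close> of \<open>E\<^sub>0\<close> bounds the excess energy by
  \<open>\<mu> (N m)\<^bsup>1/2\<^esup> \<parallel>X - X\<^sub>0\<parallel>\<close>; for \<open>X\<^sub>0\<close> the isometric polar factor of \<open>P\<^sub>0 X\<close>, \<open>\<parallel>X - X\<^sub>0\<parallel> \<le> 5/6 \<parallel>Q - P\<^sub>0\<parallel>\<close>.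
\<close>

section \<open>Frobenius inner product\<close>

lemma conj_transpose_nth [simp]: "conj_transpose X $ i $ j = cnj (X $ j $ i)"
  by (simp add: conj_transpose_def)

lemma conj_transpose_mult: "conj_transpose (A ** B) = conj_transpose B ** conj_transpose A"
  by (simp add: vec_eq_iff matrix_matrix_mult_def mult.commute)

lemma conj_transpose_conj_transpose [simp]: "conj_transpose (conj_transpose A) = A"
  by (simp add: vec_eq_iff)

lemma conj_transpose_diff: "conj_transpose (A - B) = conj_transpose A - conj_transpose B"
  by (simp add: vec_eq_iff)

lemma conj_transpose_mat_1 [simp]: "conj_transpose (mat 1) = mat 1"
  by (auto simp: vec_eq_iff mat_def)

lemma matrix_diff_ldistrib: "(A :: complex^'k^'n) ** (B - C) = A ** B - A ** C"
  by (simp add: vec_eq_iff matrix_matrix_mult_def right_diff_distrib sum_subtractf)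

lemma matrix_diff_rdistrib: "(B - C) ** (A :: complex^'k^'n) = B ** A - C ** A"
  by (simp add: vec_eq_iff matrix_matrix_mult_def left_diff_distrib sum_subtractf)

lemma inner_matrix_eq: "A \<bullet> (B :: complex^'m^'n) = Re (\<Sum>i\<in>UNIV. \<Sum>j\<in>UNIV. cnj (A $ i $ j) * B $ i $ j)"
  by (simp add: inner_vec_def inner_complex_def)

lemma inner_matrix_trace: "A \<bullet> (B :: complex^'m^'n) = Re (trace (conj_transpose A ** B))"
  unfolding inner_matrix_eq trace_def matrix_matrix_mult_def
  by (subst sum.swap) simp

lemma inner_mult_left: "(A ** B) \<bullet> (C :: complex^'m^'n) = B \<bullet> (conj_transpose A ** C)"
  by (simp add: inner_matrix_trace conj_transpose_mult matrix_mul_assoc)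

lemma inner_conj_transpose: "conj_transpose A \<bullet> conj_transpose B = A \<bullet> (B :: complex^'m^'n)"
proof -
  have "conj_transpose A \<bullet> conj_transpose B = cnj (\<Sum>j\<in>UNIV. \<Sum>i\<in>UNIV. cnj (A $ i $ j) * B $ i $ j) \<bullet> 1"
    by (simp add: inner_matrix_eq inner_complex_def)
  also have "\<dots> = A \<bullet> B"
    by (subst sum.swap) (simp add: inner_matrix_eq inner_complex_def)
  finally show ?thesis .
qed

lemma inner_mult_right: "(A ** B) \<bullet> (C :: complex^'m^'n) = A \<bullet> (C ** conj_transpose B)"
proof -
  have "(A ** B) \<bullet> C = (conj_transpose B ** conj_transpose A) \<bullet> conj_transpose C"
    by (simp only: inner_conj_transpose flip: conj_transpose_mult)
  also have "\<dots> = conj_transpose A \<bullet> conj_transpose (C ** conj_transpose B)"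
    by (simp only: inner_mult_left conj_transpose_mult)
  finally show ?thesis
    by (simp only: inner_conj_transpose)
qed

lemma inner_mult_left': "C \<bullet> (A ** B) = (conj_transpose A ** C) \<bullet> (B :: complex^'m^'n)"
  by (simp add: inner_mult_left)

lemma inner_mult_right': "C \<bullet> (A ** B) = (C ** conj_transpose B) \<bullet> (A :: complex^'m^'n)"
  by (simp add: inner_mult_right)

lemma norm_conj_transpose [simp]: "norm (conj_transpose A) = norm (A :: complex^'m^'n)"
  by (simp add: norm_eq_sqrt_inner inner_conj_transpose)

section \<open>Frobenius norm: sums of squares and norm inequalities\<close>

lemma norm_matrix_sq: "(norm (A :: complex^'m^'n))\<^sup>2 = (\<Sum>i\<in>UNIV. \<Sum>j\<in>UNIV. (cmod (A $ i $ j))\<^sup>2)"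
  by (simp add: norm_vec_def L2_set_def sum_nonneg)

lemma norm_matrix_sq_columns: "(norm (A :: complex^'m^'n))\<^sup>2 = (\<Sum>j\<in>UNIV. (norm (column j A))\<^sup>2)"
  unfolding norm_matrix_sq
  by (subst sum.swap) (simp add: norm_vec_def L2_set_def sum_nonneg column_def)

text \<open>Cauchy-Schwarz bounds each entry of the product by a row norm times a column norm;
  summing the squares over all entries factorises.\<close>

lemma norm_matrix_mult_le: "norm (A ** B) \<le> norm A * norm (B :: complex^'m^'n)"
proof -
  have "(cmod ((A ** B) $ i $ j))\<^sup>2 \<le> (\<Sum>k\<in>UNIV. (cmod (A $ i $ k))\<^sup>2) * (\<Sum>k\<in>UNIV. (cmod (B $ k $ j))\<^sup>2)" for i j
  proof -
    have "cmod ((A ** B) $ i $ j) \<le> (\<Sum>k\<in>UNIV. cmod (A $ i $ k) * cmod (B $ k $ j))"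
      unfolding matrix_matrix_mult_def by (simp add: sum_norm_le norm_mult)
    then have "(cmod ((A ** B) $ i $ j))\<^sup>2 \<le> (\<Sum>k\<in>UNIV. cmod (A $ i $ k) * cmod (B $ k $ j))\<^sup>2"
      by (intro power_mono) auto
    also note Cauchy_Schwarz_ineq_sum
    finally show ?thesis .
  qed
  then have "(norm (A ** B))\<^sup>2 \<le> (\<Sum>i\<in>UNIV. \<Sum>j\<in>UNIV. (\<Sum>k\<in>UNIV. (cmod (A $ i $ k))\<^sup>2) * (\<Sum>k\<in>UNIV. (cmod (B $ k $ j))\<^sup>2))"
    unfolding norm_matrix_sq[of "A ** B"] by (intro sum_mono)
  also have "\<dots> = (\<Sum>i\<in>UNIV. \<Sum>k\<in>UNIV. (cmod (A $ i $ k))\<^sup>2) * (\<Sum>j\<in>UNIV. \<Sum>k\<in>UNIV. (cmod (B $ k $ j))\<^sup>2)"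
    by (simp add: sum_product)
  also have "\<dots> = (norm A * norm B)\<^sup>2"
    unfolding power_mult_distrib norm_matrix_sq
    by (subst (4) sum.swap) simp
  finally show ?thesis
    by (rule power2_le_imp_le) simp
qed

text \<open>Cauchy-Schwarz against the constant 1 over all index pairs; this is the source of the
  square root of \<open>N m\<close> in the bounds on the excess energy.\<close>

lemma entrywise_l1_norm_le:
  fixes A :: "complex^'m^'n"
  shows "(\<Sum>i\<in>UNIV. \<Sum>j\<in>UNIV. cmod (A $ i $ j)) \<le> sqrt (real CARD('n) * real CARD('m)) * norm A"
proof -
  let ?S = "UNIV :: ('n \<times> 'm) set"
  have sum_pairs: "(\<Sum>p\<in>?S. g (fst p) (snd p)) = (\<Sum>i\<in>UNIV. \<Sum>j\<in>UNIV. g i j)" for g :: "'n \<Rightarrow> 'm \<Rightarrow> real"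
    unfolding UNIV_Times_UNIV[symmetric] sum.cartesian_product by (simp add: case_prod_unfold)
  have "(\<Sum>p\<in>?S. cmod (A $ fst p $ snd p) * 1)\<^sup>2 \<le> (\<Sum>p\<in>?S. (cmod (A $ fst p $ snd p))\<^sup>2) * (\<Sum>p\<in>?S. 1\<^sup>2)"
    by (rule Cauchy_Schwarz_ineq_sum)
  then have "(\<Sum>i\<in>UNIV. \<Sum>j\<in>UNIV. cmod (A $ i $ j))\<^sup>2 \<le> (norm A)\<^sup>2 * (real CARD('n) * real CARD('m))"
    unfolding norm_matrix_sq sum_pairs[of "\<lambda>i j. (cmod (A $ i $ j))\<^sup>2", symmetric]
      sum_pairs[of "\<lambda>i j. cmod (A $ i $ j)", symmetric] by simp
  then have "(\<Sum>i\<in>UNIV. \<Sum>j\<in>UNIV. cmod (A $ i $ j)) \<le> sqrt ((norm A)\<^sup>2 * (real CARD('n) * real CARD('m)))"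
    by (rule real_le_rsqrt)
  then show ?thesis
    by (simp add: real_sqrt_mult mult.commute)
qed

section \<open>Diagonal matrices and their unitary conjugates\<close>

definition diag :: "('n \<Rightarrow> real) \<Rightarrow> complex^'n^'n" where
  "diag k = (\<chi> i j. if i = j then complex_of_real (k i) else 0)"

lemma conj_transpose_diag [simp]: "conj_transpose (diag k) = diag k"
  by (auto simp: vec_eq_iff diag_def)

lemma mult_diag_nth: "(A ** diag k) $ i $ j = A $ i $ j * of_real (k j)"
proof -
  have "(A ** diag k) $ i $ j = (\<Sum>l\<in>UNIV. if l = j then A $ i $ l * of_real (k l) else 0)"
    unfolding matrix_matrix_mult_def diag_def vec_lambda_beta by (rule sum.cong) auto
  then show ?thesis by simp
qed

lemma diag_mult_diag: "diag k ** diag l = diag (\<lambda>i. k i * l i)"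
  unfolding vec_eq_iff mult_diag_nth by (auto simp: diag_def)

lemma diag_1 [simp]: "diag (\<lambda>_. 1) = mat 1"
  by (simp add: diag_def mat_def vec_eq_iff)

definition unitary :: "complex^'n^'n \<Rightarrow> bool" where
  "unitary U \<longleftrightarrow> conj_transpose U ** U = mat 1 \<and> U ** conj_transpose U = mat 1"

text \<open>Functional calculus in a fixed orthonormal eigenbasis: for unitary \<open>U\<close>,
  products become pointwise products of \<open>k\<close>, and projectors, pseudo-inverses and
  inverse square roots all have this form.\<close>

definition conj_diag :: "complex^'n^'n \<Rightarrow> ('n \<Rightarrow> real) \<Rightarrow> complex^'n^'n" where
  "conj_diag U k = U ** diag k ** conj_transpose U"

lemma unitary_cancel:
  assumes "unitary U"
  shows "A ** U ** conj_transpose U = A" "A ** conj_transpose U ** U = A"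
  using assms by (simp_all add: unitary_def flip: matrix_mul_assoc)

lemma norm_mult_unitary:
  fixes A :: "complex^'m^'n"
  assumes "unitary U"
  shows "norm (A ** U) = norm A"
proof -
  have "(A ** U) \<bullet> (A ** U) = A \<bullet> A"
    by (simp add: inner_mult_right unitary_cancel assms)
  then show ?thesis by (simp add: norm_eq_sqrt_inner)
qed

lemma conj_transpose_conj_diag [simp]: "conj_transpose (conj_diag U k) = conj_diag U k"
  by (simp add: conj_diag_def conj_transpose_mult matrix_mul_assoc)

lemma conj_diag_mult:
  assumes "unitary U"
  shows "conj_diag U k ** conj_diag U l = conj_diag U (\<lambda>i. k i * l i)"
proof -
  have "conj_diag U k ** conj_diag U l = U ** diag k ** conj_transpose U ** U ** diag l ** conj_transpose U"
    by (simp add: conj_diag_def matrix_mul_assoc)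
  also have "\<dots> = U ** (diag k ** diag l) ** conj_transpose U"
    by (simp add: unitary_cancel assms matrix_mul_assoc)
  finally show ?thesis
    by (simp add: conj_diag_def diag_mult_diag)
qed

lemma conj_diag_1: "unitary U \<Longrightarrow> conj_diag U (\<lambda>_. 1) = mat 1"
  by (simp add: conj_diag_def unitary_def)

text \<open>Pairing with a positive semidefinite matrix gives a weighted sum with nonnegative
  weights, so inequalities between eigenvalues transfer term by term.\<close>

lemma inner_conj_diag:
  fixes U :: "complex^'n^'n" and A :: "complex^'n^'k"
  shows "conj_diag U k \<bullet> (conj_transpose A ** A) = (\<Sum>j\<in>UNIV. k j * (norm (column j (A ** U)))\<^sup>2)"
proof -
  have "conj_diag U k \<bullet> (conj_transpose A ** A) = (A ** conj_diag U k) \<bullet> A"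
    by (simp add: inner_mult_left)
  also have "\<dots> = (A ** U ** diag k) \<bullet> (A ** U)"
    by (simp add: conj_diag_def matrix_mul_assoc inner_mult_right)
  also have "\<dots> = (\<Sum>i\<in>UNIV. \<Sum>j\<in>UNIV. k j * (cmod ((A ** U) $ i $ j))\<^sup>2)"
    unfolding inner_vec_def mult_diag_nth
    by (intro sum.cong refl) (simp only: inner_complex_def cmod_power2, simp add: power2_eq_square algebra_simps)
  also have "\<dots> = (\<Sum>j\<in>UNIV. k j * (norm (column j (A ** U)))\<^sup>2)"
    by (subst sum.swap) (simp add: norm_vec_def L2_set_def sum_nonneg column_def sum_distrib_left)
  finally show ?thesis .
qed

lemma inner_conj_diag_conj_diag:
  assumes "unitary U"
  shows "conj_diag U k \<bullet> conj_diag U l = (\<Sum>j\<in>UNIV. k j * l j)"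
proof -
  have "conj_diag U k \<bullet> conj_diag U l = (U ** diag k) \<bullet> (conj_diag U l ** U)"
    by (simp add: conj_diag_def[of _ k] inner_mult_right)
  also have "\<dots> = diag k \<bullet> diag l"
    using assms
    by (simp add: conj_diag_def[of _ l] inner_mult_left unitary_cancel matrix_mul_assoc) (simp add: unitary_def)
  also have "\<dots> = (\<Sum>j\<in>UNIV. k j * l j)"
    unfolding inner_vec_def diag_def by (auto simp: inner_complex_def if_distrib if_distribR intro!: sum.cong cong: if_cong)
  finally show ?thesis .
qed

section \<open>Spectral theorem and characteristic polynomial\<close>

text \<open>The sesquilinear product, conjugate-linear in the first argument. The library product
  \<open>\<bullet>\<close> is only its real part, too weak to express complex orthogonality.\<close>

definition cinner :: "complex^'n \<Rightarrow> complex^'n \<Rightarrow> complex" where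
  "cinner u v = (\<Sum>i\<in>UNIV. cnj (u $ i) * v $ i)"

lemma inner_eq_Re_cinner: "u \<bullet> v = Re (cinner u v)"
  by (simp add: inner_vec_def cinner_def inner_complex_def)

lemma cinner_self: "cinner v v = of_real ((norm v)\<^sup>2)"
  by (simp add: cinner_def norm_vec_def L2_set_def sum_nonneg mult.commute complex_norm_square
      flip: of_real_power)

lemma cnj_cinner: "cnj (cinner u v) = cinner v u"
  by (simp add: cinner_def mult.commute)

lemma cinner_scaleR_left: "cinner (r *\<^sub>R u) v = r *\<^sub>R cinner u v"
  by (simp add: cinner_def scaleR_sum_right)

lemma matrix_vector_mult_scaleR_complex: "(A :: complex^'m^'n) *v (r *\<^sub>R v) = r *\<^sub>R (A *v v)"
  by (simp add: vec_eq_iff matrix_vector_mult_def scaleR_sum_right)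

lemma cinner_matrix_vector: "cinner u (A *v v) = cinner (conj_transpose A *v u) v"
proof -
  have "cinner u (A *v v) = (\<Sum>i\<in>UNIV. \<Sum>j\<in>UNIV. cnj (u $ i) * (A $ i $ j * v $ j))"
    by (simp add: cinner_def matrix_vector_mult_def sum_distrib_left)
  also have "\<dots> = (\<Sum>j\<in>UNIV. \<Sum>i\<in>UNIV. cnj (u $ i) * (A $ i $ j * v $ j))"
    by (rule sum.swap)
  also have "\<dots> = cinner (conj_transpose A *v u) v"
    by (simp add: cinner_def matrix_vector_mult_def sum_distrib_left mult_ac)
  finally show ?thesis .
qed

text \<open>The eigenvector is a maximiser of the Rayleigh quotient on \<open>W\<close>.\<close>

lemma hermitian_eigenvector_in_subspace:
  fixes A :: "complex^'n^'n"
  assumes "hermitian A" and W: "subspace W" and inv: "\<And>v. v \<in> W \<Longrightarrow> A *v v \<in> W"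
    and "w0 \<in> W" "w0 \<noteq> 0"
  obtains v l where "v \<in> W" "norm v = 1" "A *v v = l *\<^sub>R v"
proof -
  have sym: "(A *v v) \<bullet> w = v \<bullet> (A *v w)" for v w
    using assms(1) by (simp add: inner_eq_Re_cinner cinner_matrix_vector hermitian_def)
  define K where "K = sphere 0 1 \<inter> W"
  have "compact K"
    unfolding K_def using W by (intro compact_Int_closed compact_sphere closed_subspace)
  moreover have "w0 /\<^sub>R norm w0 \<in> K"
    using assms W by (simp add: K_def subspace_scale)
  moreover have "continuous_on K (\<lambda>v. v \<bullet> (A *v v))"
    by (intro continuous_intros linear_continuous_on linear_linear[THEN iffD2] matrix_vector_mul_linear)
  ultimately obtain v where v: "v \<in> K" and max: "\<And>w. w \<in> K \<Longrightarrow> w \<bullet> (A *v w) \<le> v \<bullet> (A *v v)"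
    using continuous_attains_sup[of K] by blast
  define l where "l = v \<bullet> (A *v v)"
  have vW: "v \<in> W" and nv: "norm v = 1"
    using v by (auto simp: K_def)
  have bound: "w \<bullet> (A *v w) \<le> l * (w \<bullet> w)" if "w \<in> W" for w
  proof (cases "w = 0")
    case False
    have "w /\<^sub>R norm w \<in> K"
      using that False W by (simp add: K_def subspace_scale)
    from max[OF this] have "(w \<bullet> (A *v w)) / (norm w)\<^sup>2 \<le> l"
      by (simp add: l_def matrix_vector_mult_scaleR_complex power2_eq_square divide_inverse mult_ac)
    then show ?thesis
      using False by (simp add: field_simps power2_norm_eq_inner)
  qed simp
  define w where "w = l *\<^sub>R v - A *v v"
  define g B where "g = w \<bullet> w" and "B = l * g - w \<bullet> (A *v w)"
  have wW: "w \<in> W"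
    unfolding w_def using W vW inv by (intro subspace_diff subspace_scale) auto
  \<comment> \<open>Perturbing the maximiser to \<open>v - t w\<close>, where \<open>w\<close> is
    the residual of the eigenvalue equation: the first-order change is \<open>- 2 t g\<close>, which
    must vanish at a maximum.\<close>
  have quad: "0 \<le> t * t * B - 2 * t * g" for t
  proof -
    have "v - t *\<^sub>R w \<in> W"
      using W vW wW by (intro subspace_diff subspace_scale)
    note bound[OF this]
    moreover have "g = l * (v \<bullet> w) - (A *v v) \<bullet> w"
      unfolding g_def by (subst (1) w_def) (simp add: inner_diff_left)
    moreover have "w \<bullet> (A *v v) = (A *v v) \<bullet> w" "v \<bullet> (A *v w) = (A *v v) \<bullet> w"
      by (rule inner_commute, rule sym[symmetric])
    moreover have "v \<bullet> v = 1"
      using nv by (simp add: norm_eq_1)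
    ultimately show ?thesis
      by (simp add: B_def g_def[symmetric] matrix_vector_mult_diff_distrib matrix_vector_mult_scaleR_complex
          inner_diff_left inner_diff_right inner_commute[of w v] l_def[symmetric])
        (simp add: matrix_vector_mult_scaleR_complex algebra_simps)
  qed
  have "g = 0"
  proof (rule ccontr)
    assume "g \<noteq> 0"
    then have g: "g > 0"
      by (simp add: g_def)
    \<comment> \<open>Small enough that the second-order term cannot compensate the first-order one;
      the \<open>+ 1\<close> keeps the denominator positive.\<close>
    define t where "t = g / (\<bar>B\<bar> + 1)"
    have t: "t > 0"
      using g by (simp add: t_def)
    have tB: "t * B \<le> g"
    proof -
      have "g * B \<le> g * (\<bar>B\<bar> + 1)"
        using g by (intro mult_left_mono) auto
      then show ?thesis by (simp add: t_def field_simps)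
    qed
    have "t * (2 * g) \<le> t * (t * B)"
      using quad[of t] by (simp add: algebra_simps)
    then have "2 * g \<le> t * B"
      using t by simp
    with tB g show False by simp
  qed
  then have "A *v v = l *\<^sub>R v"
    by (simp add: g_def w_def)
  with that vW nv show ?thesis by blast
qed

text \<open>Induction on the index set: the orthogonal complement of the eigenvectors found so far
  is invariant under \<open>A\<close>, hence contains a further eigenvector.\<close>

lemma hermitian_orthonormal_eigenvectors:
  fixes A :: "complex^'n^'n" and S :: "'n set"
  assumes "hermitian A"
  shows "\<exists>u d. \<forall>i\<in>S. A *v u i = (d i :: real) *\<^sub>R u i \<and> (\<forall>j\<in>S. cinner (u i) (u j) = (if i = j then 1 else 0))"
  using finite[of S]
proof (induction S rule: finite_induct)
  case (insert x S)
  then obtain u d where ud: "\<And>i. i \<in> S \<Longrightarrow> A *v u i = (d i :: real) *\<^sub>R u i"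
      "\<And>i j. i \<in> S \<Longrightarrow> j \<in> S \<Longrightarrow> cinner (u i) (u j) = (if i = j then 1 else 0)"
    by metis
  \<comment> \<open>The kernel of \<open>M\<close> is the orthogonal complement. The row of the new
    index \<open>x\<close> is zero, so \<open>M\<close> is singular and the complement is
    nontrivial; this replaces a dimension count.\<close>
  define M :: "complex^'n^'n" where "M = (\<chi> i j. if i \<in> S then cnj (u i $ j) else 0)"
  have M: "M *v v = (\<chi> i. if i \<in> S then cinner (u i) v else 0)" for v
    by (auto simp: M_def matrix_vector_mult_def cinner_def vec_eq_iff)
  define W where "W = {v. M *v v = 0}"
  have W: "v \<in> W \<longleftrightarrow> (\<forall>i\<in>S. cinner (u i) v = 0)" for v
    by (auto simp: W_def M vec_eq_iff)
  have "row x M = 0"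
    using insert.hyps by (simp add: row_def M_def vec_eq_iff)
  then have "\<not> invertible M"
    by (simp add: invertible_det_nz det_zero_row)
  then obtain w where w: "w \<in> W" "w \<noteq> 0"
    by (auto simp: W_def invertible_left_inverse matrix_left_invertible_ker)
  have "subspace W"
    unfolding W_def by (auto simp: subspace_def matrix_vector_right_distrib matrix_vector_mult_scaleR_complex)
  moreover have "A *v v \<in> W" if "v \<in> W" for v
    using that assms ud(1) by (auto simp: W cinner_matrix_vector hermitian_def cinner_scaleR_left)
  ultimately obtain v l where v: "v \<in> W" "norm v = 1" "A *v v = l *\<^sub>R v"
    using hermitian_eigenvector_in_subspace[OF assms] w by metis
  have *: "cinner (u i) v = 0" "cinner v (u i) = 0" if "i \<in> S" for i
    using v(1) that W cnj_cinner[of "u i" v] by auto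
  have "cinner v v = 1"
    using v(2) by (simp add: cinner_self)
  then have "\<forall>i\<in>insert x S. A *v (u(x := v)) i = (d(x := l)) i *\<^sub>R (u(x := v)) i \<and>
      (\<forall>j\<in>insert x S. cinner ((u(x := v)) i) ((u(x := v)) j) = (if i = j then 1 else 0))"
    using insert.hyps ud v(3) * by auto
  then show ?case by blast
qed auto

theorem hermitian_spectral:
  fixes A :: "complex^'n^'n"
  assumes "hermitian A"
  obtains U d where "unitary U" "A = conj_diag U d"
proof -
  obtain u :: "'n \<Rightarrow> complex^'n" and d where ud: "\<And>i. A *v u i = (d i :: real) *\<^sub>R u i"
      "\<And>i j. cinner (u i) (u j) = (if i = j then 1 else 0)"
    using hermitian_orthonormal_eigenvectors[OF assms, of UNIV] by auto
  define U :: "complex^'n^'n" where "U = (\<chi> i j. u j $ i)"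
  have "conj_transpose U ** U = mat 1"
    using ud(2) by (simp add: vec_eq_iff matrix_matrix_mult_def U_def cinner_def mat_def)
  then have U: "unitary U"
    by (simp add: unitary_def matrix_left_right_inverse)
  have "(A ** U) $ i $ j = (A *v u j) $ i" for i j
    by (simp add: matrix_matrix_mult_def matrix_vector_mult_def U_def)
  then have "A ** U = U ** diag d"
    by (simp add: vec_eq_iff mult_diag_nth ud(1)) (simp add: U_def scaleR_conv_of_real)
  then have "A = conj_diag U d"
    by (metis conj_diag_def unitary_cancel(1)[OF U])
  with U that show ?thesis by blast
qed

section \<open>Eigenvalues as roots of the characteristic polynomial\<close>

lemma charpoly_conj_diag:
  fixes U :: "complex^'n^'n"
  assumes "unitary U"
  shows "charpoly (conj_diag U d) = (\<Prod>i\<in>UNIV. [:- complex_of_real (d i), 1:])"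
proof -
  \<comment> \<open>Entries become constant polynomials. This embedding is multiplicative, so the
    similarity by \<open>U\<close> can be carried out on polynomial matrices and cancelled in the
    determinant.\<close>
  define C :: "complex^'n^'n \<Rightarrow> complex poly^'n^'n" where "C A = (\<chi> i j. [:A $ i $ j:])" for A
  have sum_const: "[:sum f S:] = (\<Sum>i\<in>S. [:f i:])" for f :: "'n \<Rightarrow> complex" and S
  proof (induction S rule: infinite_finite_induct)
    case (insert x S)
    then show ?case
      using add_pCons[of "f x" 0 "sum f S" 0] by simp
  qed auto
  have C_mult: "C (A ** B) = C A ** C B" for A B
    by (simp add: C_def matrix_matrix_mult_def vec_eq_iff sum_const mult.commute)
  have C_1: "C (mat 1) = mat 1"
    by (auto simp: C_def mat_def vec_eq_iff one_pCons)
  have mat_comm: "C U ** mat p = mat p ** C U" for p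
    by (simp add: matrix_matrix_mult_def mat_def vec_eq_iff if_distrib if_distribR mult.commute cong: if_cong)
  have "charpoly (conj_diag U d) = det (mat [:0, 1:] - C U ** C (diag d) ** C (conj_transpose U))"
    by (simp add: charpoly_def conj_diag_def C_def[of "_ ** _ ** _", symmetric] C_mult)
  also have "mat [:0, 1:] - C U ** C (diag d) ** C (conj_transpose U)
      = C U ** (mat [:0, 1:] - C (diag d)) ** C (conj_transpose U)"
  proof -
    have "C U ** mat [:0, 1:] ** C (conj_transpose U) = mat [:0, 1:]"
      using assms by (simp add: mat_comm unitary_def C_1 flip: matrix_mul_assoc C_mult)
    moreover have "C U ** (X - Y) ** Z = C U ** X ** Z - C U ** Y ** Z" for X Y Z
      by (simp add: vec_eq_iff matrix_matrix_mult_def sum_subtractf left_diff_distrib right_diff_distrib)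
    ultimately show ?thesis by metis
  qed
  also have "det \<dots> = det (mat [:0, 1:] - C (diag d)) * (det (C U) * det (C (conj_transpose U)))"
    by (simp add: det_mul mult_ac)
  also have "det (C U) * det (C (conj_transpose U)) = 1"
    using assms by (simp add: unitary_def C_1 flip: det_mul C_mult)
  also have "det (mat [:0, 1:] - C (diag d)) = (\<Prod>i\<in>UNIV. (mat [:0, 1:] - C (diag d)) $ i $ i)"
    by (rule det_diagonal) (simp add: mat_def C_def diag_def)
  also have "\<dots> = (\<Prod>i\<in>UNIV. [:- complex_of_real (d i), 1:])"
    by (simp add: mat_def C_def diag_def)
  finally show ?thesis by simp
qed

lemma proots_prod_linear:
  assumes "finite S"
  shows "proots (\<Prod>i\<in>S. [:- complex_of_real (d i), 1:]) = image_mset (\<lambda>i. complex_of_real (d i)) (mset_set S)"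
proof -
  have "proots (\<Prod>i\<in>S. [:- complex_of_real (d i), 1:]) = (\<Sum>i\<in>S. {#complex_of_real (d i)#})"
    by (subst proots_prod) auto
  also have "\<dots> = image_mset (\<lambda>i. complex_of_real (d i)) (mset_set S)"
    using assms by (induction S rule: finite_induct) auto
  finally show ?thesis .
qed

text \<open>Both sides list the roots of one characteristic polynomial with multiplicity. Equality
  of multisets permits counting eigenvalues without choosing a bijection between \<open>'n\<close>
  and \<open>{1..N}\<close>.\<close>

lemma ordered_eigenvalues_mset:
  fixes U :: "complex^'n^'n"
  assumes "unitary U" "ordered_eigenvalues (conj_diag U d) lam"
  shows "image_mset d (mset_set UNIV) = image_mset lam (mset_set {1..CARD('n)})"
proof -
  have "image_mset (\<lambda>i. complex_of_real (d i)) (mset_set UNIV) =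
      image_mset (\<lambda>i. complex_of_real (lam i)) (mset_set {1..CARD('n)})"
    using assms by (simp add: ordered_eigenvalues_def charpoly_conj_diag flip: proots_prod_linear)
  then have "image_mset Re (image_mset (\<lambda>i. complex_of_real (d i)) (mset_set UNIV)) =
      image_mset Re (image_mset (\<lambda>i. complex_of_real (lam i)) (mset_set {1..CARD('n)}))"
    by simp
  then show ?thesis
    by (simp add: multiset.map_comp o_def)
qed

section \<open>Projectors and the energy\<close>

definition orthogonal_projector :: "complex^'n^'n \<Rightarrow> bool" where
  "orthogonal_projector P \<longleftrightarrow> conj_transpose P = P \<and> P ** P = P"

lemma orthogonal_projector_compl:
  "orthogonal_projector P \<Longrightarrow> orthogonal_projector (mat 1 - P)"
  by (simp add: orthogonal_projector_def conj_transpose_diff matrix_diff_ldistrib matrix_diff_rdistrib)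

text \<open>The right-hand side is the trace, so the squared norm is the rank of \<open>P\<close>;
  rank conditions on projectors are stated through it from here on.\<close>

lemma norm_sq_projector:
  assumes "orthogonal_projector P"
  shows "(norm P)\<^sup>2 = mat 1 \<bullet> P"
proof -
  have "mat 1 \<bullet> P = (P ** mat 1) \<bullet> P"
    using assms by (simp only: inner_mult_left orthogonal_projector_def)
  then show ?thesis by (simp add: power2_norm_eq_inner)
qed

lemma norm_projector_mult_sq:
  fixes X :: "complex^'m^'n"
  assumes "orthogonal_projector P"
  shows "(norm X)\<^sup>2 = (norm (P ** X))\<^sup>2 + (norm ((mat 1 - P) ** X))\<^sup>2"
proof -
  have "(norm (P ** X))\<^sup>2 = X \<bullet> (P ** X)" if "orthogonal_projector P" for P
    using that by (simp add: power2_norm_eq_inner inner_mult_left orthogonal_projector_def matrix_mul_assoc)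
  then have "(norm (P ** X))\<^sup>2 + (norm ((mat 1 - P) ** X))\<^sup>2 = X \<bullet> (P ** X) + X \<bullet> ((mat 1 - P) ** X)"
    using assms orthogonal_projector_compl by metis
  also have "\<dots> = (norm X)\<^sup>2"
    unfolding matrix_diff_rdistrib inner_diff_right by (simp add: power2_norm_eq_inner)
  finally show ?thesis by simp
qed

lemma norm_mult_projector_sq:
  fixes X :: "complex^'n^'m"
  assumes "orthogonal_projector P"
  shows "(norm X)\<^sup>2 = (norm (X ** P))\<^sup>2 + (norm (X ** (mat 1 - P)))\<^sup>2"
proof -
  have "norm (X ** P) = norm (P ** conj_transpose X)" if "orthogonal_projector P" for P
    using that norm_conj_transpose[of "X ** P"] by (simp add: conj_transpose_mult orthogonal_projector_def)
  then show ?thesis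
    using norm_projector_mult_sq[OF assms, of "conj_transpose X"] assms orthogonal_projector_compl[OF assms]
    by simp
qed

section \<open>Density matrices and the energy functional\<close>

lemma conj_transpose_density_matrix [simp]: "conj_transpose (density_matrix X) = density_matrix X"
  by (simp add: density_matrix_def conj_transpose_mult)

lemma projector_density_matrix:
  assumes "orthogonal_projector P" "P ** X = X"
  shows "P ** density_matrix X = density_matrix X" "density_matrix X ** P = density_matrix X"
proof -
  show *: "P ** density_matrix X = density_matrix X"
    using assms by (simp add: density_matrix_def matrix_mul_assoc)
  then show "density_matrix X ** P = density_matrix X"
    using assms(1) conj_transpose_mult[of P "density_matrix X"] by (simp add: orthogonal_projector_def)
qed

lemma orthogonal_projector_conj_diag:
  assumes "unitary U" "\<And>i. k i * k i = k i"
  shows "orthogonal_projector (conj_diag U k)"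
  unfolding orthogonal_projector_def conj_diag_mult[OF assms(1)] assms(2) by simp

text \<open>Cyclicity of the trace, in the form of the adjoint rules, collects the factors
  \<open>X\<close> around \<open>H\<close>; the energy thus depends on \<open>X\<close> only through
  its density matrix.\<close>

lemma energy0_eq_inner:
  assumes "hermitian H"
  shows "energy0 H X = H \<bullet> (density_matrix X + density_matrix X - density_matrix X ** density_matrix X)"
proof -
  define Z where "Z = mat 2 - conj_transpose X ** X"
  have two: "mat 2 = (mat 1 + mat 1 :: complex^'m^'m)"
    by (simp add: mat_def vec_eq_iff)
  have "conj_transpose Z = Z"
    by (simp add: Z_def vec_eq_iff matrix_matrix_mult_def mat_def mult.commute)
  then have "energy0 H X = Z \<bullet> (conj_transpose X ** H ** X)"
    by (simp add: energy0_def inner_matrix_trace Z_def)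
  also have "\<dots> = (X ** Z) \<bullet> (H ** X)"
    by (simp add: inner_mult_left matrix_mul_assoc)
  also have "\<dots> = (X ** Z ** conj_transpose X) \<bullet> H"
    by (simp add: inner_mult_right[of "X ** Z"])
  also have "X ** Z ** conj_transpose X = X ** mat 2 ** conj_transpose X - density_matrix X ** density_matrix X"
    by (simp add: Z_def density_matrix_def matrix_diff_ldistrib matrix_diff_rdistrib matrix_mul_assoc)
  also have "X ** mat 2 ** conj_transpose X = density_matrix X + density_matrix X"
    unfolding two density_matrix_def matrix_add_ldistrib matrix_mul_rid
    by (simp only: vec_eq_iff matrix_matrix_mult_def vec_lambda_beta vector_add_component distrib_right sum.distrib simp_thms)
  finally show ?thesis
    by (simp add: inner_commute)
qed

text \<open>Completing the square: \<open>P\<close> is a two-sided identity for the density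
  matrix.\<close>

lemma energy0_eq_projector:
  assumes "hermitian H" "orthogonal_projector P" "P ** X = X"
  shows "energy0 H X = H \<bullet> P - H \<bullet> ((P - density_matrix X) ** (P - density_matrix X))"
proof -
  have "P - (P - density_matrix X) ** (P - density_matrix X)
      = density_matrix X + density_matrix X - density_matrix X ** density_matrix X"
    using projector_density_matrix[OF assms(2,3)] assms(2)
    by (simp add: orthogonal_projector_def matrix_diff_ldistrib matrix_diff_rdistrib)
  then show ?thesis
    using assms(1) by (simp add: energy0_eq_inner flip: inner_diff_right)
qed

lemma hermitian_gram: "hermitian (conj_transpose X ** X)"
  by (simp add: hermitian_def conj_transpose_mult)

text \<open>
  \<open>1 / s\<close> is the pseudo-inverse on the diagonal, thanks to \<open>1 / 0 = 0\<close>; so \<open>P\<close> projects onto the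
  column space of \<open>X\<close> even if \<open>X\<close> is rank deficient.
\<close>

lemma column_space_projector:
  fixes X :: "complex^'m^'n"
  obtains P where "orthogonal_projector P" "P ** X = X" "(norm P)\<^sup>2 \<le> real CARD('m)"
    "\<And>K. K ** X = mat 1 \<Longrightarrow> P = range_projector X"
proof -
  obtain V s where V: "unitary V" and gram: "conj_transpose X ** X = conj_diag V s"
    using hermitian_spectral[OF hermitian_gram] by metis
  define T where "T = conj_diag V (\<lambda>i. 1 / s i)"
  define P where "P = X ** T ** conj_transpose X"
  have TGT: "T ** (conj_transpose X ** X) ** T = T" and GTG: "conj_diag V s ** (T ** conj_diag V s) = conj_diag V s"
    by (auto simp: gram T_def conj_diag_mult V intro!: arg_cong[where f = "conj_diag V"])
  have "P ** P = X ** (T ** (conj_transpose X ** X) ** T) ** conj_transpose X"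
    by (simp add: P_def matrix_mul_assoc)
  then have proj: "orthogonal_projector P"
    by (simp add: orthogonal_projector_def TGT) (simp add: P_def T_def conj_transpose_mult matrix_mul_assoc)
  \<comment> \<open>\<open>Z\<close> projects onto the kernel of the Gram matrix, which is also the
    kernel of \<open>X\<close>; so \<open>X Z = 0\<close>, and this says
    \<open>P X = X\<close>.\<close>
  define Z where "Z = mat 1 - T ** (conj_transpose X ** X)"
  have "(X ** Z) \<bullet> (X ** Z) = Z \<bullet> (conj_transpose X ** X ** Z)"
    by (simp add: inner_mult_left matrix_mul_assoc)
  also have "conj_transpose X ** X ** Z = 0"
    by (simp add: Z_def gram matrix_diff_ldistrib GTG)
  finally have "X ** Z = 0" by simp
  then have PX: "P ** X = X"
    by (simp add: Z_def P_def matrix_diff_ldistrib matrix_mul_assoc)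
  have "(norm P)\<^sup>2 = P \<bullet> mat 1"
    using norm_sq_projector[OF proj] by (simp add: inner_commute)
  also have "\<dots> = (X ** T) \<bullet> X"
    by (simp add: P_def inner_mult_right[of "X ** T"])
  also have "\<dots> = T \<bullet> (conj_transpose X ** X)"
    by (rule inner_mult_left)
  also have "\<dots> = (\<Sum>i\<in>UNIV. 1 / s i * s i)"
    by (simp add: gram T_def inner_conj_diag_conj_diag V)
  \<comment> \<open>Each term is 1 or, where \<open>s i = 0\<close>, 0: the sum counts the nonzero
    eigenvalues of the Gram matrix.\<close>
  also have "\<dots> \<le> (\<Sum>i\<in>(UNIV :: 'm set). 1)"
    by (intro sum_mono) auto
  finally have normP: "(norm P)\<^sup>2 \<le> real CARD('m)" by simp
  have "P = range_projector X" if "K ** X = mat 1" for K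
  proof -
    \<comment> \<open>Cancelling \<open>X\<close> on the left in \<open>P X = X\<close> shows that
      the pseudo-inverse \<open>T\<close> is a true inverse, which determines the choice made by
      \<open>matrix_inv\<close>.\<close>
    have "mat 1 = K ** (P ** X)"
      by (simp add: PX that)
    also have "\<dots> = (K ** X) ** T ** (conj_transpose X ** X)"
      by (simp add: P_def matrix_mul_assoc)
    finally have TG: "T ** (conj_transpose X ** X) = mat 1"
      by (simp add: that)
    define M where "M = matrix_inv (conj_transpose X ** X)"
    have "(conj_transpose X ** X) ** M = mat 1 \<and> M ** (conj_transpose X ** X) = mat 1"
      unfolding M_def matrix_inv_def
      by (rule someI_ex) (metis TG matrix_left_right_inverse)
    then have "M = T"
      by (metis TG matrix_mul_assoc matrix_mul_lid matrix_mul_rid)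
    then show ?thesis
      by (simp add: P_def range_projector_def M_def)
  qed
  with that proj PX normP show ?thesis by blast
qed

section \<open>Energy growth in the presence of a spectral gap\<close>

text \<open>Spectral data freed from the ordering of the eigenvalues: \<open>I\<close> indexes the
  occupied eigenvectors, \<open>a\<close> and \<open>b\<close> bound the gap, and \<open>e\<close>
  measures how far the spectrum stays below 0.\<close>

locale spectral_gap =
  fixes U :: "complex^'n^'n" and d :: "'n \<Rightarrow> real" and I :: "'n set" and a b e :: real
  assumes U: "unitary U"
    and occupied: "\<And>i. i \<in> I \<Longrightarrow> d i \<le> a"
    and unoccupied: "\<And>i. i \<notin> I \<Longrightarrow> b \<le> d i"
    and gap: "a < b" and b_neg: "b < 0"
    and e_pos: "0 < e" and d_le: "\<And>i. d i \<le> - e"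
begin

definition H where "H = conj_diag U d"
definition P0 where "P0 = conj_diag U (indicator I)"

lemma hermitian_H: "hermitian H"
  by (simp add: H_def hermitian_def)

lemma projector_P0: "orthogonal_projector P0"
  unfolding P0_def by (rule orthogonal_projector_conj_diag[OF U]) (simp add: indicator_def)

lemma H_P0: "H \<bullet> P0 = (\<Sum>i\<in>UNIV. d i * indicator I i)"
  by (simp add: H_def P0_def inner_conj_diag_conj_diag[OF U])

lemma norm_P0_sq: "(norm P0)\<^sup>2 = real (card I)"
proof -
  have "(norm P0)\<^sup>2 = (\<Sum>i\<in>UNIV. indicator I i * indicator I i)"
    by (simp add: power2_norm_eq_inner P0_def inner_conj_diag_conj_diag[OF U])
  also have "\<dots> = (\<Sum>i\<in>UNIV. if i \<in> I then 1 else 0)"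
    by (intro sum.cong) (auto simp: indicator_def)
  finally show ?thesis by (simp add: sum.If_cases)
qed

text \<open>The projector distributes weights \<open>t i\<close> in \<open>[0, 1]\<close> over the
  eigenvectors of \<open>H\<close>. Weight missing on \<open>I\<close> is charged at
  \<open>a\<close> and weight outside \<open>I\<close> at \<open>b\<close>.\<close>

lemma projector_energy_growth:
  assumes P: "orthogonal_projector P" and "(norm P)\<^sup>2 \<le> real (card I)"
  shows "(b - a) / 2 * (norm (P - P0))\<^sup>2 \<le> H \<bullet> P - H \<bullet> P0"
proof -
  define t where "t i = (norm (column i (P ** U)))\<^sup>2" for i
  define occ :: "'n \<Rightarrow> real" where "occ = indicator I"
  define k m tau where "k = (norm P)\<^sup>2" and "m = real (card I)" and "tau = P0 \<bullet> P"
  have PP: "conj_transpose P ** P = P"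
    using P by (simp add: orthogonal_projector_def)
  have inner_P: "conj_diag U f \<bullet> P = (\<Sum>i\<in>UNIV. f i * t i)" for f
    using inner_conj_diag[of U f P] by (simp add: PP t_def)
  have t_le: "t i \<le> 1" for i
  proof -
    define Q where "Q = mat 1 - P"
    \<comment> \<open>Writing the complement as a Gram matrix makes its diagonal entries
      \<open>1 - t i\<close> in the eigenbasis nonnegative.\<close>
    have Q: "conj_transpose Q ** Q = mat 1 - P"
      using orthogonal_projector_compl[OF P] by (simp add: Q_def orthogonal_projector_def)
    have "0 \<le> conj_diag U (indicator {i}) \<bullet> (mat 1 - P)"
      unfolding Q[symmetric] inner_conj_diag by (intro sum_nonneg) auto
    also have "\<dots> = (\<Sum>j\<in>UNIV. indicator {i} j * (1 - t j))"
      unfolding inner_diff_right conj_diag_1[OF U, symmetric] inner_P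
      by (simp add: inner_conj_diag_conj_diag[OF U] right_diff_distrib sum_subtractf)
    also have "\<dots> = 1 - t i"
      by (subst sum.remove[of _ i]) (auto simp: indicator_def intro!: sum.neutral)
    finally show ?thesis by simp
  qed
  have k: "k = (\<Sum>i\<in>UNIV. t i)"
    using norm_sq_projector[OF P] inner_P[of "\<lambda>_. 1"] by (simp add: k_def conj_diag_1[OF U])
  have tau: "tau = (\<Sum>i\<in>UNIV. occ i * t i)"
    by (simp add: tau_def P0_def inner_P occ_def)
  have m: "m = (\<Sum>i\<in>UNIV. occ i)"
    by (simp add: m_def occ_def indicator_def sum.If_cases)
  have "tau \<le> m"
    unfolding tau m by (intro sum_mono) (auto simp: occ_def indicator_def t_le)
  have "k \<le> m"
    using assms(2) by (simp add: k_def m_def)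
  have "a * (tau - m) + b * (k - tau) = (\<Sum>i\<in>UNIV. (a * occ i) * (t i - 1) + b * ((1 - occ i) * t i))"
    by (simp add: tau m k sum_distrib_left algebra_simps flip: sum.distrib sum_subtractf)
  also have "\<dots> \<le> (\<Sum>i\<in>UNIV. d i * (t i - occ i))"
  proof (rule sum_mono)
    fix i
    show "(a * occ i) * (t i - 1) + b * ((1 - occ i) * t i) \<le> d i * (t i - occ i)"
    proof (cases "i \<in> I")
      case True
      then have "a * (t i - 1) \<le> d i * (t i - 1)"
        using occupied t_le by (intro mult_right_mono_neg) auto
      with True show ?thesis by (simp add: occ_def)
    next
      case False
      then have "b * t i \<le> d i * t i"
        using unoccupied by (intro mult_right_mono) (auto simp: t_def)
      with False show ?thesis by (simp add: occ_def)
    qed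
  qed
  also have "\<dots> = H \<bullet> P - H \<bullet> P0"
    by (simp add: H_def inner_P) (simp add: H_P0[unfolded H_def] occ_def right_diff_distrib sum_subtractf)
  finally have lower: "a * (tau - m) + b * (k - tau) \<le> H \<bullet> P - H \<bullet> P0" .
  have "(norm (P - P0))\<^sup>2 = k + m - 2 * tau"
    by (simp add: k_def m_def tau_def norm_P0_sq[symmetric] power2_norm_eq_inner inner_diff_left
        inner_diff_right inner_commute)
  \<comment> \<open>Here \<open>P\<close> may have rank \<open>k\<close> below \<open>m\<close>:
    \<open>k \<le> m\<close> bounds the squared distance by \<open>2 (m - tau)\<close>, and since
    \<open>b\<close> is negative the missing rank can only raise the energy.\<close>
  also have "(b - a) / 2 * \<dots> \<le> (b - a) / 2 * (2 * (m - tau))"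
    using gap \<open>k \<le> m\<close> by (intro mult_left_mono) auto
  also have "\<dots> = (b - a) * (m - tau)" by simp
  also have "\<dots> \<le> (b - a) * (m - tau) + b * (k - m)"
    using b_neg \<open>k \<le> m\<close> by (simp add: mult_nonpos_nonpos)
  also have "\<dots> = a * (tau - m) + b * (k - tau)"
    by (simp add: algebra_simps)
  also note lower
  finally show ?thesis by simp
qed

section \<open>Coercivity of the energy, globally and near \<open>P0\<close>\<close>

lemma inner_H_square_le:
  assumes "conj_transpose D = D"
  shows "H \<bullet> (D ** D) \<le> - e * (norm D)\<^sup>2"
proof -
  have "H \<bullet> (D ** D) = (\<Sum>j\<in>UNIV. d j * (norm (column j (D ** U)))\<^sup>2)"
    using inner_conj_diag[of U d D] by (simp add: H_def assms)
  also have "\<dots> \<le> (\<Sum>j\<in>UNIV. - e * (norm (column j (D ** U)))\<^sup>2)"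
    by (intro sum_mono mult_right_mono d_le) auto
  also have "\<dots> = - e * (norm D)\<^sup>2"
    using norm_mult_unitary[OF U, of D] norm_matrix_sq_columns[of "D ** U"] by (simp add: sum_distrib_left)
  finally show ?thesis .
qed

text \<open>As \<open>b < 0\<close>, occupied eigenvalues satisfy
  \<open>d j \<le> a \<le> - (b - a)\<close>, and the others are negative. On the occupied space the
  gap thus replaces \<open>e\<close>, which may be much smaller.\<close>

lemma inner_H_square_le_occupied:
  assumes D: "conj_transpose D = D"
  shows "H \<bullet> (D ** D) \<le> - (b - a) * (norm (D ** P0))\<^sup>2"
proof -
  have "(norm (D ** P0))\<^sup>2 = (D ** P0) \<bullet> D"
    using projector_P0
    by (simp add: power2_norm_eq_inner inner_mult_right orthogonal_projector_def flip: matrix_mul_assoc)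
  also have "\<dots> = P0 \<bullet> (conj_transpose D ** D)"
    by (rule inner_mult_left)
  finally have norm: "(norm (D ** P0))\<^sup>2 = (\<Sum>j\<in>UNIV. indicator I j * (norm (column j (D ** U)))\<^sup>2)"
    by (simp only: P0_def inner_conj_diag)
  have "H \<bullet> (D ** D) = (\<Sum>j\<in>UNIV. d j * (norm (column j (D ** U)))\<^sup>2)"
    using inner_conj_diag[of U d D] by (simp add: H_def D)
  also have "\<dots> \<le> (\<Sum>j\<in>UNIV. - (b - a) * (indicator I j * (norm (column j (D ** U)))\<^sup>2))"
  proof (rule sum_mono)
    fix j
    have "d j \<le> - (b - a) * indicator I j"
      using occupied[of j] d_le[of j] b_neg e_pos by (auto simp: indicator_def)
    then show "d j * (norm (column j (D ** U)))\<^sup>2 \<le> - (b - a) * (indicator I j * (norm (column j (D ** U)))\<^sup>2)"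
      unfolding mult.assoc[symmetric] by (intro mult_right_mono) auto
  qed
  finally show ?thesis
    unfolding norm sum_distrib_left .
qed

text \<open>Valid at any distance from \<open>P0\<close>, but with the constant \<open>e\<close>; it
  identifies the minimizers at \<open>\<mu> = 0\<close> and localises those for small
  \<open>\<mu>\<close>.\<close>

lemma energy0_growth:
  fixes X :: "complex^'m^'n"
  assumes P: "orthogonal_projector P" and PX: "P ** X = X" and norm_P: "(norm P)\<^sup>2 \<le> real (card I)"
  shows "(b - a) / 2 * (norm (P - P0))\<^sup>2 + e * (norm (P - density_matrix X))\<^sup>2 \<le> energy0 H X - H \<bullet> P0"
proof -
  define D where "D = P - density_matrix X"
  have "conj_transpose D = D"
    using P by (simp add: D_def conj_transpose_diff orthogonal_projector_def)
  from inner_H_square_le[OF this] projector_energy_growth[OF P norm_P]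
  show ?thesis
    unfolding energy0_eq_projector[OF hermitian_H P PX] D_def[symmetric] by simp
qed

text \<open>The defect \<open>D\<close> satisfies \<open>D P = D\<close>, so for \<open>P\<close>
  close to \<open>P0\<close> most of \<open>D\<close> acts on the occupied space, where the gap is
  available as coercivity constant.\<close>

lemma energy0_growth_local:
  fixes X :: "complex^'m^'n"
  assumes P: "orthogonal_projector P" and PX: "P ** X = X" and norm_P: "(norm P)\<^sup>2 \<le> real (card I)"
    and near: "norm (P - P0) \<le> 1 / 4"
  shows "(b - a) / 2 * ((norm (P - P0))\<^sup>2 + (norm (P - density_matrix X))\<^sup>2) \<le> energy0 H X - H \<bullet> P0"
proof -
  define D where "D = P - density_matrix X"
  have D: "conj_transpose D = D" and DP: "D ** P = D"
    using P projector_density_matrix[OF P PX]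
    by (simp_all add: D_def conj_transpose_diff orthogonal_projector_def matrix_diff_rdistrib)
  have "norm D \<le> norm (D ** P0) + norm (D ** (P - P0))"
    using norm_triangle_ineq[of "D ** P0" "D ** (P - P0)"] by (simp add: matrix_diff_ldistrib DP)
  also have "norm (D ** (P - P0)) \<le> norm D * norm (P - P0)"
    by (rule norm_matrix_mult_le)
  also have "\<dots> \<le> norm D * (1 / 4)"
    using near by (intro mult_left_mono) auto
  finally have "3 / 4 * norm D \<le> norm (D ** P0)" by simp
  then have "(3 / 4 * norm D)\<^sup>2 \<le> (norm (D ** P0))\<^sup>2"
    by (intro power_mono) auto
  \<comment> \<open>The square of \<open>3/4\<close> is \<open>9/16\<close>, which exceeds
    \<open>1/2\<close>.\<close>
  then have "(norm D)\<^sup>2 / 2 \<le> (norm (D ** P0))\<^sup>2"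
    unfolding power_mult_distrib by (simp add: power_divide) (use zero_le_power2[of "norm D"] in linarith)
  then have "(b - a) * ((norm D)\<^sup>2 / 2) \<le> (b - a) * (norm (D ** P0))\<^sup>2"
    using gap by (intro mult_left_mono) auto
  also have "\<dots> \<le> - (H \<bullet> (D ** D))"
    using inner_H_square_le_occupied[OF D] by (simp add: left_diff_distrib)
  finally have "(b - a) / 2 * (norm D)\<^sup>2 \<le> - (H \<bullet> (D ** D))" by simp
  with projector_energy_growth[OF P norm_P] show ?thesis
    unfolding energy0_eq_projector[OF hermitian_H P PX] D_def[symmetric] distrib_left by linarith
qed

text \<open>
  Compressed to the range of \<open>P\<close>, the difference \<open>P - P0\<close> equals \<open>(P - P0)\<^sup>2\<close>; hence the cross term
  below is of third order.
\<close>

lemma norm_density_matrix_diff_le: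
  fixes X :: "complex^'m^'n"
  assumes P: "orthogonal_projector P" and PX: "P ** X = X"
  defines "p \<equiv> norm (P - density_matrix X)" and "r \<equiv> norm (P - P0)"
  shows "(norm (density_matrix X - P0))\<^sup>2 \<le> p\<^sup>2 + r\<^sup>2 + 2 * p * r\<^sup>2"
proof -
  define D where "D = density_matrix X - P"
  define R where "R = P - P0"
  have herm: "conj_transpose P = P" and PP: "P ** P = P" "\<And>A. A ** P ** P = A ** P"
      and P0P0: "P0 ** P0 = P0" "\<And>A. A ** P0 ** P0 = A ** P0"
    using P projector_P0 by (simp_all add: orthogonal_projector_def flip: matrix_mul_assoc)
  have D: "P ** D ** P = D"
    using projector_density_matrix[OF P PX] PP
    by (simp add: D_def matrix_diff_ldistrib matrix_diff_rdistrib)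
  have compress: "A \<bullet> (P ** B ** P) = (P ** A ** P) \<bullet> B" for A B
    by (simp only: inner_mult_right'[of A] inner_mult_left'[of _ P] herm matrix_mul_assoc)
  have "D \<bullet> R = D \<bullet> (P ** R ** P)"
    by (simp add: compress D)
  also have "P ** R ** P = P ** (R ** R) ** P"
    by (simp add: R_def matrix_diff_ldistrib matrix_diff_rdistrib matrix_mul_assoc PP P0P0)
  also have "D \<bullet> (P ** (R ** R) ** P) = D \<bullet> (R ** R)"
    by (simp add: compress D)
  also have "\<dots> \<le> norm D * norm (R ** R)"
    by (rule norm_cauchy_schwarz)
  also have "\<dots> \<le> norm D * (norm R * norm R)"
    by (intro mult_left_mono norm_matrix_mult_le) auto
  finally have "D \<bullet> R \<le> p * r\<^sup>2"
    by (simp add: p_def r_def R_def D_def norm_minus_commute power2_eq_square)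
  moreover have "(norm (D + R))\<^sup>2 = p\<^sup>2 + r\<^sup>2 + 2 * (D \<bullet> R)"
    unfolding power2_norm_eq_inner p_def r_def
    by (simp add: D_def R_def inner_add_left inner_add_right inner_diff_left inner_diff_right inner_commute)
  moreover have "D + R = density_matrix X - P0"
    by (simp add: D_def R_def)
  ultimately show ?thesis by simp
qed

text \<open>
  \<open>X0\<close> is the isometric factor of the polar decomposition of \<open>P0 X\<close>.
\<close>

lemma nearest_minimizer:
  fixes X :: "complex^'m^'n"
  assumes card: "card I = CARD('m)"
  defines "D \<equiv> density_matrix X - P0"
  assumes near: "norm D \<le> 1 / 4"
  obtains X0 :: "complex^'m^'n" and K where "density_matrix X0 = P0"
    "(norm (X - X0))\<^sup>2 \<le> 2 / 3 * (norm D)\<^sup>2" "K ** X = mat 1"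
proof -
  have P0: "conj_transpose P0 = P0" "P0 ** P0 = P0"
    using projector_P0 by (simp_all add: orthogonal_projector_def)
  define W Y where "W = P0 ** X" and "Y = (mat 1 - P0) ** X"
  have P0W: "P0 ** W = W"
    by (simp add: W_def matrix_mul_assoc P0)
  have WX: "conj_transpose W ** X = conj_transpose W ** W"
    by (simp add: W_def conj_transpose_mult P0 matrix_mul_assoc flip: matrix_mul_assoc[of _ P0 P0])
  \<comment> \<open>The \<open>c j\<close> are the squared singular values of \<open>W\<close>;
    closeness to \<open>P0\<close> will put them near 1.\<close>
  obtain V c where V: "unitary V" and gram: "conj_transpose W ** W = conj_diag V c"
    using hermitian_spectral[OF hermitian_gram] by metis
  have norm_sq: "(norm Z)\<^sup>2 = mat 1 \<bullet> (conj_transpose Z ** Z)" for Z :: "complex^'m^'n"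
    by (simp add: inner_mult_left'[of _ "conj_transpose Z"] power2_norm_eq_inner)
  have sum_c: "(norm W)\<^sup>2 = (\<Sum>j\<in>UNIV. c j)"
    by (simp add: norm_sq gram inner_conj_diag_conj_diag V flip: conj_diag_1[OF V])
  have mat_1: "mat 1 \<bullet> (mat 1 :: complex^'m^'m) = real CARD('m)"
    by (simp add: inner_conj_diag_conj_diag V flip: conj_diag_1[OF V])
  \<comment> \<open>The right-hand side is the squared distance from the Gram matrix of
    \<open>Z\<close> to the identity. It reduces an \<open>N\<close>-dimensional distance to an
    \<open>m\<close>-dimensional one, because \<open>P0\<close> has rank \<open>m\<close>.\<close>
  have norm_density_diff: "(norm (density_matrix Z - P0))\<^sup>2
      = (conj_transpose Z ** Z) \<bullet> (conj_transpose Z ** Z) - 2 * (norm Z)\<^sup>2 + real CARD('m)"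
    if "P0 ** Z = Z" for Z :: "complex^'m^'n"
  proof -
    have "density_matrix Z \<bullet> density_matrix Z = Z \<bullet> (Z ** (conj_transpose Z ** Z))"
      by (simp add: density_matrix_def inner_mult_right[of Z] matrix_mul_assoc)
    also have "\<dots> = (conj_transpose Z ** Z) \<bullet> (conj_transpose Z ** Z)"
      by (rule inner_mult_left')
    finally have "density_matrix Z \<bullet> density_matrix Z = (conj_transpose Z ** Z) \<bullet> (conj_transpose Z ** Z)" .
    moreover have "density_matrix Z \<bullet> P0 = (norm Z)\<^sup>2"
      by (simp add: density_matrix_def inner_mult_right[of Z] that power2_norm_eq_inner)
    ultimately show ?thesis
      using norm_P0_sq
      by (simp add: card power2_norm_eq_inner inner_diff_left inner_diff_right inner_commute)
  qed
  have diag_block: "(norm (P0 ** D ** P0))\<^sup>2 = (\<Sum>j\<in>UNIV. (c j - 1)\<^sup>2)"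
  proof -
    have "P0 ** D ** P0 = density_matrix W - P0"
      by (simp add: D_def density_matrix_def W_def conj_transpose_mult P0 matrix_diff_ldistrib
          matrix_diff_rdistrib matrix_mul_assoc)
    also have "(norm \<dots>)\<^sup>2 = (\<Sum>j\<in>UNIV. c j * c j - 2 * c j + 1)"
      by (simp add: norm_density_diff P0W gram inner_conj_diag_conj_diag V sum_c sum.distrib
          sum_subtractf sum_distrib_left)
    finally show ?thesis
      by (simp add: power2_eq_square algebra_simps)
  qed
  define F where "F = (mat 1 - P0) ** D ** P0"
  have "norm (P0 ** D ** (mat 1 - P0)) = norm F"
  proof -
    have "conj_transpose F = P0 ** D ** (mat 1 - P0)"
      by (simp add: F_def D_def conj_transpose_mult conj_transpose_diff P0 matrix_mul_assoc)
    then show ?thesis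
      using norm_conj_transpose[of F] by simp
  qed
  moreover have "(norm F)\<^sup>2 \<le> (norm ((mat 1 - P0) ** D))\<^sup>2"
    using norm_mult_projector_sq[OF projector_P0, of "(mat 1 - P0) ** D"] by (simp add: F_def)
  \<comment> \<open>Block decomposition of \<open>D\<close> along \<open>P0\<close>: the two
    off-diagonal blocks are adjoint to each other, hence the factor 2.\<close>
  ultimately have blocks: "(\<Sum>j\<in>UNIV. (c j - 1)\<^sup>2) + 2 * (norm F)\<^sup>2 \<le> (norm D)\<^sup>2"
    using norm_projector_mult_sq[OF projector_P0, of D] norm_mult_projector_sq[OF projector_P0, of "P0 ** D"]
    by (simp add: diag_block)
  have c_ge: "3 / 4 \<le> c j" for j
  proof -
    have "(c j - 1)\<^sup>2 \<le> (\<Sum>j\<in>UNIV. (c j - 1)\<^sup>2)"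
      by (rule member_le_sum) auto
    also have "\<dots> \<le> (norm D)\<^sup>2"
      using blocks by (smt (verit) zero_le_power2)
    finally have "\<bar>c j - 1\<bar> \<le> norm D"
      by (simp add: abs_le_square_iff[symmetric])
    with near show ?thesis by simp
  qed
  have c_pos: "0 < c j" "c j \<noteq> 0" "sqrt (c j) * sqrt (c j) = c j" for j
    using c_ge[of j] by auto
  \<comment> \<open>\<open>Y\<close> is the part of \<open>X\<close> outside the range of
    \<open>P0\<close>. The off-diagonal block is \<open>F = Y W\<^sup>*\<close>, and the lower bound
    on the Gram matrix of \<open>W\<close> lets \<open>F\<close> control \<open>Y\<close>.\<close>
  have "3 / 4 * (norm Y)\<^sup>2 \<le> (norm F)\<^sup>2"
  proof -
    have "F = Y ** conj_transpose W"
      by (simp add: F_def D_def density_matrix_def W_def Y_def conj_transpose_mult P0 matrix_diff_ldistrib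
          matrix_diff_rdistrib matrix_mul_assoc)
    then have "(norm F)\<^sup>2 = Y \<bullet> (Y ** (conj_transpose W ** W))"
      by (simp add: power2_norm_eq_inner inner_mult_right[of Y] matrix_mul_assoc)
    also have "\<dots> = conj_diag V c \<bullet> (conj_transpose Y ** Y)"
      by (simp add: inner_mult_left'[of Y] gram inner_commute)
    also have "\<dots> \<ge> (\<Sum>j\<in>UNIV. 3 / 4 * (norm (column j (Y ** V)))\<^sup>2)"
      unfolding inner_conj_diag by (intro sum_mono mult_right_mono c_ge) auto
    also have "(\<Sum>j\<in>UNIV. 3 / 4 * (norm (column j (Y ** V)))\<^sup>2) = 3 / 4 * (norm Y)\<^sup>2"
      using norm_mult_unitary[OF V, of Y] norm_matrix_sq_columns[of "Y ** V"] by (simp add: sum_distrib_left)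
    finally show ?thesis .
  qed
  \<comment> \<open>The inverse square root of the Gram matrix of \<open>W\<close>.\<close>
  define S where "S = conj_diag V (\<lambda>j. 1 / sqrt (c j))"
  define X0 where "X0 = W ** S"
  have P0X0: "P0 ** X0 = X0"
    by (simp add: X0_def matrix_mul_assoc P0W)
  have X0X0: "conj_transpose X0 ** X0 = mat 1"
  proof -
    have "conj_transpose X0 ** X0 = S ** (conj_transpose W ** W) ** S"
      by (simp add: X0_def S_def conj_transpose_mult matrix_mul_assoc)
    also have "\<dots> = conj_diag V (\<lambda>_. 1)"
      unfolding S_def gram conj_diag_mult[OF V]
      by (intro arg_cong[where f = "conj_diag V"] ext) (use c_pos in \<open>simp add: field_simps\<close>)
    finally show ?thesis
      by (simp add: conj_diag_1 V)
  qed
  then have norm_X0: "(norm X0)\<^sup>2 = real CARD('m)"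
    by (simp add: norm_sq mat_1)
  have "(norm (density_matrix X0 - P0))\<^sup>2 = 0"
    by (simp add: norm_density_diff P0X0 X0X0 norm_X0 mat_1)
  then have density: "density_matrix X0 = P0" by simp
  have "W \<bullet> X0 = (\<Sum>j\<in>UNIV. c j * (1 / sqrt (c j)))"
    by (simp only: X0_def inner_mult_left' gram S_def inner_conj_diag_conj_diag[OF V])
  also have "\<dots> = (\<Sum>j\<in>UNIV. sqrt (c j))"
    using c_pos(1) by (intro sum.cong) (auto simp: real_div_sqrt less_imp_le)
  finally have W_X0: "W \<bullet> X0 = (\<Sum>j\<in>UNIV. sqrt (c j))" .
  have "(norm (W - X0))\<^sup>2 = (norm W)\<^sup>2 - 2 * (W \<bullet> X0) + (norm X0)\<^sup>2"
    by (simp add: power2_norm_eq_inner inner_diff_left inner_diff_right inner_commute)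
  also have "\<dots> = (\<Sum>j\<in>UNIV. c j - 2 * sqrt (c j) + 1)"
    by (simp add: sum_c W_X0 norm_X0 sum.distrib sum_subtractf sum_distrib_left)
  also have "\<dots> \<le> (\<Sum>j\<in>UNIV. 2 / 3 * (c j - 1)\<^sup>2)"
  proof (rule sum_mono)
    fix j
    \<comment> \<open>With the singular value \<open>s\<close>, the left side is
      \<open>(s - 1)\<^sup>2\<close> and \<open>(c j - 1)\<^sup>2\<close> is
      \<open>(s - 1)\<^sup>2 (s + 1)\<^sup>2\<close>; so \<open>2/3\<close> follows from
      \<open>(s + 1)\<^sup>2 \<ge> 3/2\<close>.\<close>
    define s where "s = sqrt (c j)"
    have s: "c j = s\<^sup>2" "1 / 2 \<le> s"
      unfolding s_def using c_pos(1)[of j] c_ge[of j]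
      by (simp, intro real_le_rsqrt) (simp add: power_divide)
    have "3 / 2 \<le> (s + 1)\<^sup>2"
      using power_mono[of "3 / 2" "s + 1" 2] s(2) by (simp add: power2_eq_square)
    then have "(s - 1)\<^sup>2 * (3 / 2) \<le> (s - 1)\<^sup>2 * (s + 1)\<^sup>2"
      by (intro mult_left_mono) auto
    also have "\<dots> = (c j - 1)\<^sup>2"
      by (simp add: s power2_eq_square algebra_simps)
    finally show "c j - 2 * sqrt (c j) + 1 \<le> 2 / 3 * (c j - 1)\<^sup>2"
      unfolding s_def[symmetric] using s(1) by (simp add: power2_diff)
  qed
  finally have "(norm (W - X0))\<^sup>2 \<le> 2 / 3 * (\<Sum>j\<in>UNIV. (c j - 1)\<^sup>2)"
    by (simp add: sum_distrib_left)
  moreover have "(norm (X - X0))\<^sup>2 = (norm (W - X0))\<^sup>2 + (norm Y)\<^sup>2"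
    using norm_projector_mult_sq[OF projector_P0, of "X - X0"]
    by (simp add: matrix_diff_ldistrib P0X0 W_def Y_def matrix_diff_rdistrib[of _ _ X0])
  \<comment> \<open>The two parts share the factor \<open>2/3\<close>: the squared norm of
    \<open>Y\<close> is at most \<open>4/3\<close> that of \<open>F\<close>, and \<open>F\<close>
    counts twice in \<open>blocks\<close>.\<close>
  ultimately have "(norm (X - X0))\<^sup>2 \<le> 2 / 3 * (norm D)\<^sup>2"
    using blocks \<open>3 / 4 * (norm Y)\<^sup>2 \<le> (norm F)\<^sup>2\<close> by linarith
  \<comment> \<open>\<open>W\<^sup>* X\<close> equals the Gram matrix of \<open>W\<close>, which is
    invertible because all \<open>c j\<close> are positive; hence \<open>X\<close> has a left
    inverse.\<close>
  moreover have "(conj_diag V (\<lambda>j. 1 / c j) ** conj_transpose W) ** X = mat 1"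
  proof -
    have "(conj_diag V (\<lambda>j. 1 / c j) ** conj_transpose W) ** X = conj_diag V (\<lambda>j. 1 / c j) ** conj_diag V c"
      by (simp add: WX gram flip: matrix_mul_assoc)
    also have "\<dots> = conj_diag V (\<lambda>_. 1)"
      unfolding conj_diag_mult[OF V]
      by (intro arg_cong[where f = "conj_diag V"] ext) (use c_pos in simp)
    finally show ?thesis
      by (simp add: conj_diag_1 V)
  qed
  ultimately show thesis
    using that density by blast
qed

end

section \<open>Minimizers\<close>

lemma rank_left_invertible:
  fixes X :: "'a::field^'m^'n"
  assumes "K ** X = mat 1"
  shows "rank X = CARD('m)"
proof -
  have "vec.span (rows X) = UNIV"
    using assms matrix_left_invertible_span_rows_gen by blast
  then show ?thesis
    by (metis row_rank_def_gen vec.dim_span vec_dim_card)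
qed

lemma (in spectral_gap) density_matrix_P0:
  assumes "card I = CARD('m)"
  shows "\<exists>X :: complex^'m^'n. density_matrix X = P0"
proof -
  \<comment> \<open>The columns of \<open>X\<close> are the occupied eigenvectors, relabelled by the
    column type.\<close>
  obtain f :: "'m \<Rightarrow> 'n" where f: "bij_betw f UNIV I"
    using assms finite_same_card_bij[of "UNIV :: 'm set" I] by auto
  define X :: "complex^'m^'n" where "X = (\<chi> i j. U $ i $ f j)"
  have "density_matrix X $ i $ k = P0 $ i $ k" for i k
  proof -
    have "density_matrix X $ i $ k = (\<Sum>j\<in>UNIV. U $ i $ f j * cnj (U $ k $ f j))"
      by (simp add: density_matrix_def matrix_matrix_mult_def X_def)
    also have "\<dots> = (\<Sum>l\<in>I. U $ i $ l * cnj (U $ k $ l))"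
      by (rule sum.reindex_bij_betw[OF f])
    also have "\<dots> = (\<Sum>l\<in>UNIV. if l \<in> I then U $ i $ l * cnj (U $ k $ l) else 0)"
      by (simp add: sum.If_cases)
    also have "\<dots> = (\<Sum>l\<in>UNIV. (U ** diag (indicator I)) $ i $ l * cnj (U $ k $ l))"
      unfolding mult_diag_nth by (intro sum.cong) (auto simp: indicator_def)
    also have "\<dots> = P0 $ i $ k"
      by (simp add: P0_def conj_diag_def matrix_matrix_mult_def[of "U ** _"])
    finally show ?thesis .
  qed
  then show ?thesis
    by (auto simp: vec_eq_iff)
qed

lemma (in spectral_gap) energy0_density_matrix_P0:
  "density_matrix X = P0 \<Longrightarrow> energy0 H X = H \<bullet> P0"
  using projector_P0 by (simp add: energy0_eq_inner hermitian_H orthogonal_projector_def)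

text \<open>The excess energy is at most 0, yet bounds two nonnegative terms from above; both
  vanish, so the column space projector equals both \<open>P0\<close> and the density
  matrix.\<close>

lemma (in spectral_gap) density_matrix_minimizer0:
  fixes X :: "complex^'m^'n"
  assumes card: "card I = CARD('m)" and X: "X \<in> minimizers H 0"
  shows "density_matrix X = P0"
proof -
  obtain X1 :: "complex^'m^'n" where X1: "density_matrix X1 = P0"
    using density_matrix_P0[OF card] by blast
  have "energy H 0 X \<le> energy H 0 X1"
    using X by (simp add: minimizers_def)
  then have *: "energy0 H X \<le> H \<bullet> P0"
    by (simp add: energy_def energy0_density_matrix_P0[OF X1])
  obtain P where P: "orthogonal_projector P" "P ** X = X" "(norm P)\<^sup>2 \<le> real CARD('m)"
    by (rule column_space_projector)
  have "(b - a) / 2 * (norm (P - P0))\<^sup>2 + e * (norm (P - density_matrix X))\<^sup>2 \<le> 0"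
    using energy0_growth[OF P(1,2)] P(3) * by (simp add: card)
  moreover have "0 \<le> (b - a) / 2 * (norm (P - P0))\<^sup>2" "0 \<le> e * (norm (P - density_matrix X))\<^sup>2"
    using gap e_pos by auto
  ultimately have "(b - a) / 2 * (norm (P - P0))\<^sup>2 = 0" "e * (norm (P - density_matrix X))\<^sup>2 = 0"
    by linarith+
  then show ?thesis
    using gap e_pos by simp
qed

text \<open>Comparison with \<open>Y\<close> leaves \<open>\<mu>\<close> times a difference of l1
  norms. Dropping the norm of \<open>X\<close> gives an a priori bound; the reverse triangle
  inequality gives one that improves as \<open>X\<close> approaches \<open>Y\<close>.\<close>

lemma (in spectral_gap) minimizer_excess_energy:
  fixes X Y :: "complex^'m^'n"
  assumes "X \<in> minimizers H \<mu>" "0 \<le> \<mu>" "density_matrix Y = P0"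
  shows "energy0 H X - H \<bullet> P0 \<le> \<mu> * sqrt (real CARD('n) * real CARD('m)) * norm Y"
    "energy0 H X - H \<bullet> P0 \<le> \<mu> * sqrt (real CARD('n) * real CARD('m)) * norm (X - Y)"
proof -
  let ?l1 = "\<lambda>A :: complex^'m^'n. \<Sum>i\<in>UNIV. \<Sum>j\<in>UNIV. cmod (A $ i $ j)"
  have "energy H \<mu> X \<le> energy H \<mu> Y"
    using assms(1) by (simp add: minimizers_def)
  then have *: "energy0 H X - H \<bullet> P0 \<le> \<mu> * (?l1 Y - ?l1 X)"
    by (simp add: energy_def energy0_density_matrix_P0[OF assms(3)] right_diff_distrib)
  have "?l1 Y - ?l1 X \<le> ?l1 Y"
    by (simp add: sum_nonneg)
  also note entrywise_l1_norm_le
  finally have 1: "?l1 Y - ?l1 X \<le> sqrt (real CARD('n) * real CARD('m)) * norm Y" .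
  have "?l1 Y - ?l1 X \<le> ?l1 (X - Y)"
    unfolding sum_subtractf[symmetric] vector_minus_component
    by (intro sum_mono) (metis norm_minus_commute norm_triangle_ineq2)
  also note entrywise_l1_norm_le
  finally have 2: "?l1 Y - ?l1 X \<le> sqrt (real CARD('n) * real CARD('m)) * norm (X - Y)" .
  show "energy0 H X - H \<bullet> P0 \<le> \<mu> * sqrt (real CARD('n) * real CARD('m)) * norm Y"
    "energy0 H X - H \<bullet> P0 \<le> \<mu> * sqrt (real CARD('n) * real CARD('m)) * norm (X - Y)"
    using * mult_left_mono[OF 1 assms(2)] mult_left_mono[OF 2 assms(2)] by (simp_all add: mult.assoc)
qed

text \<open>Two passes: the a priori bound and global growth bring \<open>X\<close> close enough for
  the local estimates; comparison with the nearby \<open>X0\<close> then makes the bound linear in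
  \<open>\<mu>\<close>.\<close>

lemma (in spectral_gap) minimizer_density_matrix_bound:
  fixes X :: "complex^'m^'n"
  defines "L \<equiv> sqrt (real CARD('n) * real CARD('m))"
  assumes card: "card I = CARD('m)" and X: "X \<in> minimizers H \<mu>" and "0 < \<mu>"
    and small: "\<mu> * (real CARD('m) * sqrt (real CARD('n))) \<le> (b - a) / 128"
      "\<mu> * (real CARD('m) * sqrt (real CARD('n))) \<le> e / 100"
  shows "rank X = CARD('m)"
    "(b - a) * norm (density_matrix X - P0) \<le> 2 * (\<mu> * L)"
    "(b - a) * norm (range_projector X - P0) \<le> 2 * (\<mu> * L)"
proof -
  obtain P where P: "orthogonal_projector P" "P ** X = X" "(norm P)\<^sup>2 \<le> real CARD('m)"
      "\<And>K. K ** X = mat 1 \<Longrightarrow> P = range_projector X"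
    by (rule column_space_projector) blast
  define p r where "p = norm (P - density_matrix X)" and "r = norm (P - P0)"
  define \<delta> where "\<delta> = norm (density_matrix X - P0)"
  have nonneg: "0 \<le> p" "0 \<le> r" "0 \<le> \<delta>"
    by (simp_all add: p_def r_def \<delta>_def)
  have "energy0 H X - H \<bullet> P0 \<le> \<mu> * (real CARD('m) * sqrt (real CARD('n)))"
  proof -
    obtain X1 :: "complex^'m^'n" where X1: "density_matrix X1 = P0"
      using density_matrix_P0[OF card] by blast
    have "real CARD('m) = mat 1 \<bullet> (X1 ** conj_transpose X1)"
      using norm_P0_sq norm_sq_projector[OF projector_P0] by (simp add: card X1[symmetric] density_matrix_def)
    also have "\<dots> = (norm X1)\<^sup>2"
      by (simp add: inner_mult_right' power2_norm_eq_inner)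
    finally have "norm X1 = sqrt (real CARD('m))"
      by simp
    then have "L * norm X1 = (real CARD('m) * sqrt (real CARD('n)))"
      by (simp add: L_def real_sqrt_mult)
    then show ?thesis
      using minimizer_excess_energy(1)[OF X _ X1] \<open>0 < \<mu>\<close> by (simp add: L_def mult.assoc)
  qed
  moreover have "(b - a) / 2 * r\<^sup>2 + e * p\<^sup>2 \<le> energy0 H X - H \<bullet> P0"
    unfolding p_def r_def using P(1-3) by (intro energy0_growth) (auto simp: card)
  moreover have "0 \<le> (b - a) / 2 * r\<^sup>2" "0 \<le> e * p\<^sup>2"
    using gap e_pos by auto
  \<comment> \<open>The smallness thresholds are chosen for this: \<open>1/128\<close> is half of
    \<open>1/64\<close>, and \<open>1/100\<close> is the square of \<open>1/10\<close>.\<close>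
  ultimately have "(b - a) * r\<^sup>2 \<le> (b - a) * (1 / 8)\<^sup>2" "e * p\<^sup>2 \<le> e * (1 / 10)\<^sup>2"
    using small by (simp_all add: power2_eq_square)
  then have "r\<^sup>2 \<le> (1 / 8)\<^sup>2" "p\<^sup>2 \<le> (1 / 10)\<^sup>2"
    using gap e_pos by (simp_all only: mult_le_cancel_left_pos diff_gt_0_iff_gt)
  then have r: "r \<le> 1 / 8" and p: "p \<le> 1 / 10"
    by - (rule power2_le_imp_le; simp)+
  \<comment> \<open>\<open>1/8 + 1/10\<close> stays below the radius \<open>1/4\<close> required by
    \<open>nearest_minimizer\<close>.\<close>
  have "\<delta> \<le> p + r"
    unfolding \<delta>_def p_def r_def using norm_triangle_ineq[of "density_matrix X - P" "P - P0"]
    by (simp add: norm_minus_commute)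
  then have "norm (density_matrix X - P0) \<le> 1 / 4"
    using p r by (simp add: \<delta>_def)
  then obtain X0 :: "complex^'m^'n" and K where X0: "density_matrix X0 = P0"
      "(norm (X - X0))\<^sup>2 \<le> 2 / 3 * \<delta>\<^sup>2" "K ** X = mat 1"
    unfolding \<delta>_def using nearest_minimizer[OF card] by metis
  show "rank X = CARD('m)"
    using X0(3) by (rule rank_left_invertible)
  \<comment> \<open>\<open>5/6\<close> is a rational upper bound for the square root of
    \<open>2/3\<close>.\<close>
  have "(norm (X - X0))\<^sup>2 \<le> (5 / 6 * \<delta>)\<^sup>2"
  proof -
    have "(5 / 6 * \<delta>)\<^sup>2 = 25 / 36 * \<delta>\<^sup>2"
      by (simp add: power2_eq_square)
    then show ?thesis
      using X0(2) zero_le_power2[of \<delta>] by linarith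
  qed
  then have "norm (X - X0) \<le> 5 / 6 * \<delta>"
    by (rule power2_le_imp_le) (use nonneg in simp)
  then have "\<mu> * L * norm (X - X0) \<le> \<mu> * L * (5 / 6 * \<delta>)"
    using \<open>0 < \<mu>\<close> by (intro mult_left_mono) (auto simp: L_def)
  moreover have "energy0 H X - H \<bullet> P0 \<le> \<mu> * L * norm (X - X0)"
    using minimizer_excess_energy(2)[OF X _ X0(1)] \<open>0 < \<mu>\<close> by (simp add: L_def)
  moreover have "(b - a) / 2 * (r\<^sup>2 + p\<^sup>2) \<le> energy0 H X - H \<bullet> P0"
    unfolding p_def r_def using P(1-3) r by (intro energy0_growth_local) (auto simp: card r_def)
  ultimately have growth: "(b - a) * (r\<^sup>2 + p\<^sup>2) \<le> 5 / 3 * (\<mu> * L) * \<delta>"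
    by simp
  have "\<delta>\<^sup>2 \<le> p\<^sup>2 + r\<^sup>2 + 2 * p * r\<^sup>2"
    unfolding \<delta>_def p_def r_def by (rule norm_density_matrix_diff_le[OF P(1,2)])
  \<comment> \<open>Since \<open>p\<close> is small, the third-order term costs only the factor
    \<open>6/5\<close>, and \<open>6/5\<close> times the \<open>5/3\<close> of \<open>growth\<close>
    is the final constant 2.\<close>
  also have "2 * p * r\<^sup>2 \<le> 2 * (1 / 10) * r\<^sup>2"
    using p by (intro mult_right_mono) auto
  finally have "\<delta>\<^sup>2 \<le> 6 / 5 * (r\<^sup>2 + p\<^sup>2)"
    using zero_le_power2[of p] unfolding distrib_left by linarith
  then have "(b - a) * \<delta>\<^sup>2 \<le> (b - a) * (6 / 5 * (r\<^sup>2 + p\<^sup>2))"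
    using gap by (intro mult_left_mono) auto
  also have "\<dots> = 6 / 5 * ((b - a) * (r\<^sup>2 + p\<^sup>2))"
    by (rule mult.left_commute)
  also have "\<dots> \<le> 2 * (\<mu> * L) * \<delta>"
    using growth by linarith
  finally have "(b - a) * \<delta> * \<delta> \<le> 2 * (\<mu> * L) * \<delta>"
    by (simp add: power2_eq_square mult.assoc)
  moreover have "0 \<le> \<mu> * L"
    using \<open>0 < \<mu>\<close> by (simp add: L_def)
  ultimately show bound: "(b - a) * norm (density_matrix X - P0) \<le> 2 * (\<mu> * L)"
    unfolding \<delta>_def[symmetric] using nonneg(3) by (cases "\<delta> = 0") auto
  \<comment> \<open>Combining \<open>growth\<close> with the bound on \<open>\<delta>\<close> gives
    \<open>r\<close> the same constant 2, without a loss from the triangle inequality.\<close>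
  have "((b - a) * r)\<^sup>2 = (b - a) * ((b - a) * r\<^sup>2)"
    by (simp add: power2_eq_square)
  also have "\<dots> \<le> (b - a) * ((b - a) * (r\<^sup>2 + p\<^sup>2))"
    using gap by (intro mult_left_mono) auto
  also have "\<dots> \<le> (b - a) * (2 * (\<mu> * L) * \<delta>)"
  proof (rule mult_left_mono)
    have "0 \<le> \<mu> * L * \<delta>"
      using nonneg(3) \<open>0 \<le> \<mu> * L\<close> by simp
    then show "(b - a) * (r\<^sup>2 + p\<^sup>2) \<le> 2 * (\<mu> * L) * \<delta>"
      using growth by linarith
  qed (use gap in simp)
  also have "\<dots> = 2 * (\<mu> * L) * ((b - a) * \<delta>)"
    by simp
  also have "\<dots> \<le> 2 * (\<mu> * L) * (2 * (\<mu> * L))"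
    using bound \<open>0 \<le> \<mu> * L\<close> unfolding \<delta>_def by (intro mult_left_mono) auto
  also have "\<dots> = (2 * (\<mu> * L))\<^sup>2"
    by (simp add: power2_eq_square)
  finally have "(b - a) * r \<le> 2 * (\<mu> * L)"
    by (rule power2_le_imp_le) (use \<open>0 \<le> \<mu> * L\<close> in simp)
  then show "(b - a) * norm (range_projector X - P0) \<le> 2 * (\<mu> * L)"
    by (simp add: r_def P(4)[OF X0(3)])
qed

section \<open>Ordered eigenvalues and the choice of the threshold\<close>

theorem corollary3:
  fixes H :: "complex^'n^'n" and lam :: "nat \<Rightarrow> real" and \<alpha> :: real
  assumes "CARD('m::finite) < CARD('n)"
    and "hermitian H" and "negative_definite H"
    and "ordered_eigenvalues H lam" and "lam CARD('n) < 0"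
    and "lam CARD('m) < lam (CARD('m) + 1)"
    and "0 < \<alpha>" and "\<alpha> < 1"
  shows "\<exists>\<mu>0>0. \<forall>\<mu>. 0 < \<mu> \<and> \<mu> < \<mu>0 \<longrightarrow>
    (\<forall>X \<in> (minimizers H \<mu> :: (complex^'m^'n) set).
       rank X = CARD('m) \<and>
       (\<forall>X0 \<in> (minimizers H 0 :: (complex^'m^'n) set).
          norm (density_matrix X - density_matrix X0)
            \<le> 2 * \<mu> * real CARD('m) * sqrt (real CARD('n))
                / (\<alpha>\<^sup>2 * (lam (CARD('m) + 1) - lam CARD('m))) \<and>
          norm (range_projector X - density_matrix X0)
            \<le> 4 * \<mu> * real CARD('m) * sqrt (real CARD('n))
                / (\<alpha>\<^sup>2 * (lam (CARD('m) + 1) - lam CARD('m)))))"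
proof -
  define m N where "m = CARD('m)" and "N = CARD('n)"
  define a b where "a = lam m" and "b = lam (m + 1)"
  have mN: "m < N" "0 < m" and ab: "a < b" and mono: "mono_on {1..N} lam"
    using assms(1,4,6) by (simp_all add: m_def N_def a_def b_def ordered_eigenvalues_def)
  obtain U d where U: "unitary U" and H: "H = conj_diag U d"
    using hermitian_spectral[OF assms(2)] by metis
  have mset: "image_mset d (mset_set UNIV) = image_mset lam (mset_set {1..N})"
    using ordered_eigenvalues_mset[OF U] assms(4) by (simp add: H N_def)
  then have "set_mset (image_mset d (mset_set UNIV)) = set_mset (image_mset lam (mset_set {1..N}))"
    by simp
  then have range_d: "range d = lam ` {1..N}"
    by simp
  have lam_le: "lam k \<le> a" if "k \<in> {1..N}" "k \<le> m" for k
    using that mN mono_onD[OF mono, of k m] by (simp add: a_def)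
  have lam_ge: "b \<le> lam k" if "k \<in> {1..N}" "\<not> k \<le> m" for k
    using that mN mono_onD[OF mono, of "m + 1" k] by (simp add: b_def)
  have lam_N: "lam k \<le> lam N" if "k \<in> {1..N}" for k
    using that mN mono_onD[OF mono, of k N] by simp
  define I where "I = {i. d i \<le> a}"
  \<comment> \<open>Counting eigenvalues up to \<open>a\<close> in the common multiset; the strict
    gap after position \<open>m\<close> makes the count exactly \<open>m\<close>.\<close>
  have "card I = size (filter_mset (\<lambda>x. x \<le> a) (image_mset d (mset_set UNIV)))"
    by (simp add: filter_mset_image_mset filter_mset_mset_set I_def)
  also have "\<dots> = card {k \<in> {1..N}. lam k \<le> a}"
    unfolding mset by (simp add: filter_mset_image_mset filter_mset_mset_set)
  also have "{k \<in> {1..N}. lam k \<le> a} = {1..m}"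
    using lam_le lam_ge ab mN by fastforce
  finally have card: "card I = CARD('m)"
    by (simp add: m_def)
  have d: "\<exists>k\<in>{1..N}. d i = lam k" for i
    using range_d by blast
  interpret G: spectral_gap U d I a b "- lam N"
  proof
    show "b \<le> d i" if "i \<notin> I" for i
      using d[of i] that lam_le lam_ge by (force simp: I_def)
    show "b < 0"
      using lam_N[of "m + 1"] mN assms(5) by (simp add: b_def N_def)
    show "d i \<le> - (- lam N)" for i
      using d[of i] lam_N by auto
  qed (use U ab assms(5) in \<open>auto simp: I_def N_def\<close>)
  have H_eq: "H = G.H"
    by (simp add: H G.H_def)
  define c where "c = real m * sqrt (real N)"
  have c: "0 < c"
    using mN by (simp add: c_def)
  \<comment> \<open>Chosen so that \<open>\<mu> m sqrt N\<close> stays below both smallness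
    thresholds.\<close>
  define \<mu>0 where "\<mu>0 = min ((b - a) / 128) (- lam N / 100) / c"
  have "0 < \<mu>0"
    using c ab assms(5) by (simp add: \<mu>0_def N_def)
  moreover have "rank X = CARD('m) \<and>
       (\<forall>X0 \<in> (minimizers H 0 :: (complex^'m^'n) set).
          norm (density_matrix X - density_matrix X0) \<le> 2 * \<mu> * real m * sqrt (real N) / (\<alpha>\<^sup>2 * (b - a)) \<and>
          norm (range_projector X - density_matrix X0) \<le> 4 * \<mu> * real m * sqrt (real N) / (\<alpha>\<^sup>2 * (b - a)))"
    if \<mu>: "0 < \<mu>" "\<mu> < \<mu>0" and X: "X \<in> minimizers H \<mu>" for \<mu> and X :: "complex^'m^'n"
  proof -
    have "\<mu> * c \<le> \<mu>0 * c"
      using \<mu> c by (intro mult_right_mono) auto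
    also have "\<mu>0 * c = min ((b - a) / 128) (- lam N / 100)"
      using c by (simp add: \<mu>0_def)
    finally have small: "\<mu> * (real CARD('m) * sqrt (real CARD('n))) \<le> (b - a) / 128"
      "\<mu> * (real CARD('m) * sqrt (real CARD('n))) \<le> - lam N / 100"
      by (simp_all add: c_def m_def N_def)
    note bounds = G.minimizer_density_matrix_bound[OF card X[unfolded H_eq] \<mu>(1) small, folded m_def N_def]
    \<comment> \<open>As \<open>m \<ge> 1\<close>, the constant \<open>sqrt (N m)\<close> is at most
      \<open>m sqrt N\<close>; division by \<open>\<alpha>\<^sup>2 \<le> 1\<close> relaxes the bound
      further.\<close>
    have "real m \<le> real m * real m"
      using mN by (simp add: Suc_le_eq flip: of_nat_mult)
    then have "sqrt (real N * real m) \<le> sqrt (real N * (real m * real m))"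
      by (intro real_sqrt_le_mono mult_left_mono) auto
    also have "\<dots> = c"
      by (simp add: c_def real_sqrt_mult)
    finally have "\<mu> * sqrt (real N * real m) \<le> \<mu> * c"
      using \<mu> by simp
    then have *: "x \<le> 2 * \<mu> * real m * sqrt (real N) / (\<alpha>\<^sup>2 * (b - a))"
      if "(b - a) * x \<le> 2 * (\<mu> * sqrt (real N * real m))" "0 \<le> x" for x
    proof -
      have "\<alpha>\<^sup>2 \<le> 1"
        using assms(7,8) by (simp add: power_le_one)
      then have "\<alpha>\<^sup>2 * ((b - a) * x) \<le> 1 * ((b - a) * x)"
        using that ab by (intro mult_right_mono) auto
      also have "\<dots> \<le> 2 * (\<mu> * c)"
        using that \<open>\<mu> * sqrt (real N * real m) \<le> \<mu> * c\<close> by simp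
      finally show ?thesis
        using ab assms(7) by (simp add: pos_le_divide_eq c_def mult_ac)
    qed
    have "2 * \<mu> * real m * sqrt (real N) / (\<alpha>\<^sup>2 * (b - a)) \<le> 4 * \<mu> * real m * sqrt (real N) / (\<alpha>\<^sup>2 * (b - a))"
      using ab \<mu> by (intro divide_right_mono mult_right_mono) auto
    moreover have "density_matrix X0 = G.P0" if "X0 \<in> minimizers H 0" for X0 :: "complex^'m^'n"
      using G.density_matrix_minimizer0[OF card] that H_eq by metis
    ultimately show ?thesis
      using bounds(1) *[OF bounds(2)] *[OF bounds(3)] by (auto simp: m_def)
  qed
  ultimately show ?thesis
    unfolding a_def b_def m_def N_def by blast
qed

end
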